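(* Let $\mathcal W$ be the set of symmetric periodic waves described in the context, and let $\tau$ be the trace map described there. Let $\mathcal C \subset \mathcal W$ be a set of waves such that $\tau(\mathcal C)$ is a connected subset of $(C^0[0,L])^7$ (with the sup-norm topology). Suppose that $\mathcal C$ contains at least one trivial wave, and that every wave in $\mathcal C$ satisfies $$ g-\gamma(0)\, u > 0 \quad \text{at the trough } (L,\eta(L)).$$ Then for every wave in $\mathcal C$, the slope of every streamline satisfies $|v/u|<1$ everywhere in $\overline\Omega$.
   Context: Fix constants $g>0$, $L>0$ and $P_{\mathrm{atm}}\in\mathbb R$. A wave is a 5-tuple $(u,v,P,\eta,d)$ with $d>0$, $\eta\in C^4$ $2L$-periodic with mean zero, and $u,v,P\in C^3(\overline\Omega)$ $2L$-periodic in $x$, where $\Omega=\{(x,y): -L<x<L,\ -d<y<\eta(x)\}$ (extended periodically), with $u,P,\eta$ even in $x$ and $v$ odd in $x$, satisfying $uu_x+vu_y=-P_x$, $uv_x+vv_y=-P_y-g$, $u_x+v_y=0$ in $\{-d<y<\eta(x)\}$; $P=P_{\mathrm{atm}}$ and $v=\eta_x u$ on $y=\eta(x)$; $v=0$ on $y=-d$. (Here $(u,v)$ is the velocity relative to a frame moving with the wave.) It is assumed that $\sup_\Omega u<0$. Then there is a stream function $\psi$ with $\psi_y=u$, $\psi_x=-v$, $\psi=0$ on the free surface and $\psi=m>0$ on $y=-d$, and a vorticity function $\gamma\in C^2[0,m]$ with $v_x-u_y=\gamma(\psi)$; it is assumed that $\gamma\le0$, $\gamma'\le0$, $\gamma''\le0$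 on $(0,m)$. A wave is trivial if $u,v,\eta,P$ depend only on $y$ (then $v\equiv0$, $\eta\equiv0$). Let $\Omega^+=\{0<x<L,\ -d<y<\eta(x)\}$, $S^+=\{(x,\eta(x)):0<x<L\}$. A wave is monotone if $v>0$ in $\Omega^+\cup S^+$. $\mathcal W$ is the set of all such waves (with $L$ fixed) that are either monotone or trivial. The crest is $(0,\eta(0))$ and the trough is $(L,\eta(L))$. The map $\tau:\mathcal W\to (C^0[0,L])^7$ is $\tau(u,v,P,\eta,d)(x)=(u,v,u_x,v_x,u_y,u_{xx},u_{xy})(x,\eta(x))$. *)

theory Defs
  imports "HOL-Analysis.Analysis"
begin

definition pdx :: "(real \<times> real \<Rightarrow> real) \<Rightarrow> real \<times> real \<Rightarrow> real" where
  "pdx f = (\<lambda>(x,y). deriv (\<lambda>s. f (s,y)) x)"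

definition pdy :: "(real \<times> real \<Rightarrow> real) \<Rightarrow> real \<times> real \<Rightarrow> real" where
  "pdy f = (\<lambda>(x,y). deriv (\<lambda>t. f (x,t)) y)"

fun Ck_on :: "nat \<Rightarrow> (real \<times> real) set \<Rightarrow> (real \<times> real \<Rightarrow> real) \<Rightarrow> bool" where
  "Ck_on 0 U f = continuous_on U f"
| "Ck_on (Suc k) U f =
     (continuous_on U f \<and>
      (\<forall>p\<in>U. (\<lambda>s. f (s, snd p)) differentiable (at (fst p)) \<and>
              (\<lambda>t. f (fst p, t)) differentiable (at (snd p))) \<and>
      Ck_on k U (pdx f) \<and> Ck_on k U (pdy f))"

definition Ck_closure :: "nat \<Rightarrow> (real \<times> real) set \<Rightarrow> (real \<times> real \<Rightarrow> real) \<Rightarrow> bool" where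
  "Ck_closure k U f =
     (Ck_on k U f \<and> continuous_on (closure U) f \<and>
      (\<forall>i j. i + j \<le> k \<longrightarrow>
         (\<exists>h. continuous_on (closure U) h \<and> (\<forall>p\<in>U. h p = (pdx ^^ i) ((pdy ^^ j) f) p))))"

definition bval :: "(real \<times> real) set \<Rightarrow> (real \<times> real \<Rightarrow> real) \<Rightarrow> real \<times> real \<Rightarrow> real" where
  "bval U f p = Lim (at p within U) f"

definition Ck_real :: "nat \<Rightarrow> (real \<Rightarrow> real) \<Rightarrow> bool" where
  "Ck_real k f = ((\<forall>i<k. \<forall>x. (deriv ^^ i) f differentiable (at x)) \<and> continuous_on UNIV ((deriv ^^ k) f))"

definition C2_interval :: "real \<Rightarrow> (real \<Rightarrow> real) \<Rightarrow> (real \<Rightarrow> real) \<Rightarrow> (real \<Rightarrow> real) \<Rightarrow> bool" where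
  "C2_interval m \<gamma> \<gamma>1 \<gamma>2 =
     ((\<forall>s\<in>{0..m}. (\<gamma> has_real_derivative \<gamma>1 s) (at s within {0..m}) \<and>
                  (\<gamma>1 has_real_derivative \<gamma>2 s) (at s within {0..m})) \<and>
      continuous_on {0..m} \<gamma>2)"

type_synonym wave =
  "(real \<times> real \<Rightarrow> real) \<times> (real \<times> real \<Rightarrow> real) \<times> (real \<times> real \<Rightarrow> real) \<times> (real \<Rightarrow> real) \<times> real"

definition wu :: "wave \<Rightarrow> real \<times> real \<Rightarrow> real" where "wu w = fst w"
definition wv :: "wave \<Rightarrow> real \<times> real \<Rightarrow> real" where "wv w = fst (snd w)"
definition wP :: "wave \<Rightarrow> real \<times> real \<Rightarrow> real" where "wP w = fst (snd (snd w))"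
definition weta :: "wave \<Rightarrow> real \<Rightarrow> real" where "weta w = fst (snd (snd (snd w)))"
definition wd :: "wave \<Rightarrow> real" where "wd w = snd (snd (snd (snd w)))"

definition Dom :: "wave \<Rightarrow> (real \<times> real) set" where
  "Dom w = {(x,y). - wd w < y \<and> y < weta w x}"

definition wave_with ::
  "real \<Rightarrow> real \<Rightarrow> real \<Rightarrow> wave \<Rightarrow> (real \<times> real \<Rightarrow> real) \<Rightarrow> real \<Rightarrow> (real \<Rightarrow> real) \<Rightarrow> bool" where
  "wave_with g L Patm w \<psi> m \<gamma> =
    (let u = wu w; v = wv w; P = wP w; \<eta> = weta w; d = wd w; \<Omega> = Dom w in
     d > 0 \<and> (\<forall>x. \<eta> x > - d) \<and>
     Ck_real 4 \<eta> \<and> (\<forall>x. \<eta> (x + 2 * L) = \<eta> x) \<and> integral {-L..L} \<eta> = 0 \<and>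
     (\<forall>x. \<eta> (- x) = \<eta> x) \<and>
     Ck_closure 3 \<Omega> u \<and> Ck_closure 3 \<Omega> v \<and> Ck_closure 3 \<Omega> P \<and>
     (\<forall>x y. (x,y) \<in> closure \<Omega> \<longrightarrow>
        u (x + 2 * L, y) = u (x,y) \<and> v (x + 2 * L, y) = v (x,y) \<and> P (x + 2 * L, y) = P (x,y)) \<and>
     (\<forall>x y. (x,y) \<in> closure \<Omega> \<longrightarrow>
        u (-x, y) = u (x,y) \<and> P (-x, y) = P (x,y) \<and> v (-x, y) = - v (x,y)) \<and>
     (\<forall>p\<in>\<Omega>. u p * pdx u p + v p * pdy u p = - pdx P p \<and>
             u p * pdx v p + v p * pdy v p = - pdy P p - g \<and>
             pdx u p + pdy v p = 0) \<and>
     (\<forall>x. P (x, \<eta> x) = Patm \<and> v (x, \<eta> x) = deriv \<eta> x * u (x, \<eta> x)) \<and>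
     (\<forall>x. v (x, - d) = 0) \<and>
     (\<exists>c<0. \<forall>p\<in>\<Omega>. u p \<le> c) \<and>
     \<comment> \<open>stream function\<close>
     m > 0 \<and> continuous_on (closure \<Omega>) \<psi> \<and>
     (\<forall>p\<in>\<Omega>. (\<lambda>t. \<psi> (fst p, t)) differentiable (at (snd p)) \<and>
             (\<lambda>s. \<psi> (s, snd p)) differentiable (at (fst p)) \<and>
             pdy \<psi> p = u p \<and> pdx \<psi> p = - v p) \<and>
     (\<forall>x. \<psi> (x, \<eta> x) = 0) \<and> (\<forall>x. \<psi> (x, - d) = m) \<and>
     \<comment> \<open>vorticity function\<close>
     (\<exists>\<gamma>1 \<gamma>2. C2_interval m \<gamma> \<gamma>1 \<gamma>2 \<and>
        (\<forall>s\<in>{0<..<m}. \<gamma> s \<le> 0 \<and> \<gamma>1 s \<le> 0 \<and> \<gamma>2 s \<le> 0)) \<and>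
     (\<forall>p\<in>\<Omega>. pdx v p - pdy u p = \<gamma> (\<psi> p)))"

definition is_wave :: "real \<Rightarrow> real \<Rightarrow> real \<Rightarrow> wave \<Rightarrow> bool" where
  "is_wave g L Patm w = (\<exists>\<psi> m \<gamma>. wave_with g L Patm w \<psi> m \<gamma>)"

definition trivial_wave :: "wave \<Rightarrow> bool" where
  "trivial_wave w =
    ((\<forall>x x'. weta w x = weta w x') \<and>
     (\<forall>x x' y. (x,y) \<in> closure (Dom w) \<longrightarrow> (x',y) \<in> closure (Dom w) \<longrightarrow>
        wu w (x,y) = wu w (x',y) \<and> wv w (x,y) = wv w (x',y) \<and> wP w (x,y) = wP w (x',y)))"

definition monotone_wave :: "real \<Rightarrow> wave \<Rightarrow> bool" where
  "monotone_wave L w =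
    (\<forall>p \<in> {(x,y). 0 < x \<and> x < L \<and> - wd w < y \<and> y < weta w x}
          \<union> {(x, weta w x) | x. 0 < x \<and> x < L}. wv w p > 0)"

definition Waves :: "real \<Rightarrow> real \<Rightarrow> real \<Rightarrow> wave set" where
  "Waves g L Patm = {w. is_wave g L Patm w \<and> (monotone_wave L w \<or> trivial_wave w)}"

type_synonym r7 = "real \<times> real \<times> real \<times> real \<times> real \<times> real \<times> real"

text \<open>tau(w)(x) = (u, v, u_x, v_x, u_y, u_xx, u_xy) at (x, eta x), for x in [0,L]
  (set to 0 outside [0,L]); derivatives are the continuous extensions to the boundary.\<close>
definition tau :: "real \<Rightarrow> wave \<Rightarrow> real \<Rightarrow> r7" where
  "tau L w = (\<lambda>x. if x \<in> {0..L} then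
      (let p = (x, weta w x); \<Omega> = Dom w; u = wu w; v = wv w in
        (u p, v p, bval \<Omega> (pdx u) p, bval \<Omega> (pdx v) p, bval \<Omega> (pdy u) p,
         bval \<Omega> (pdx (pdx u)) p, bval \<Omega> (pdy (pdx u)) p))
      else 0)"

definition C0space :: "real \<Rightarrow> (real \<Rightarrow> r7) set" where
  "C0space L = {f. continuous_on {0..L} f \<and> (\<forall>x. x \<notin> {0..L} \<longrightarrow> f x = 0)}"

definition supdist :: "real \<Rightarrow> (real \<Rightarrow> r7) \<Rightarrow> (real \<Rightarrow> r7) \<Rightarrow> real" where
  "supdist L f h = (SUP x\<in>{0..L}. norm (f x - h x))"

definition C0top :: "real \<Rightarrow> (real \<Rightarrow> r7) topology" where
  "C0top L = Metric_space.mtopology (C0space L) (supdist L)"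

end

(*
  Along the surface, Bernoulli's law and the kinematic condition give
    (u^2 - v^2) u_x + u v (u_y + v_x) + g v = 0.
  Since gamma', gamma'' <= 0 and uv <= 0, the weak maximum principle applies to u_x on a half period,
  where u_x vanishes on the lateral sides and is nonpositive on the bottom. A nonnegative maximum
  of u_x on the surface would be a critical point along the surface with u_xy >= 0; differentiating the
  identity above there makes a quadratic form in u_x and u_y + v_x nonpositive, while the trough
  condition, which propagates to g >= |gamma(0)| (u^2 + v^2)^(1/2) on the whole surface, makes it
  positive. Hence u_x <= 0. At the first surface point counted from the crest with v = -u, the
  derivative of u + v along the surface is 2 u_x + gamma(0) >= 0, so u_x = 0 is again such a
  maximum. Thus u + v < 0 on the surface, and the maximum principle carries this inside.
*)
theory Submission
  imports Defs
begin

section \<open>Partial derivatives and the weak maximum principle\<close>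

text \<open>The obstacle is the steep regime. Before the slope is bounded, v may exceed -u on the
  surface, so the quadratic form has to be positive for every ratio of v to -u. The form arises by
  multiplying the differentiated surface identity by 2 u v and eliminating g with the identity
  itself. What remains is affine in c = -\<gamma>(0), and the bounds c (-u) <= g and c v <= g decide
  between which two values of c it is enough to check.

  At a surface maximum of u_x the vertical comparison gives only u_xy >= 0. Strictness comes
  entirely from the form, which stays positive for u_x = 0 and u_xy = 0. This is why one lemma
  serves twice: it excludes u_x > 0, and it excludes the value u_x = 0 that a first point of slope
  -1 would produce.

  Derivatives live on the surface only as continuous extensions from inside, so differentiating the
  identity along the surface rests on a chain rule for a curve lying in the boundary of the
  domain.\<close>

definition partials :: "(real \<times> real) set \<Rightarrow> (real \<times> real \<Rightarrow> real) \<Rightarrow> (real \<times> real \<Rightarrow> real) \<Rightarrow> (real \<times> real \<Rightarrow> real) \<Rightarrow> bool" where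
  "partials S f fx fy \<longleftrightarrow>
     (\<forall>x y. (x,y) \<in> S \<longrightarrow>
        ((\<lambda>s. f (s,y)) has_real_derivative fx (x,y)) (at x) \<and>
        ((\<lambda>t. f (x,t)) has_real_derivative fy (x,y)) (at y))"

lemma partialsD:
  assumes "partials S f fx fy" "(x,y) \<in> S"
  shows "((\<lambda>s. f (s,y)) has_real_derivative fx (x,y)) (at x)"
    and "((\<lambda>t. f (x,t)) has_real_derivative fy (x,y)) (at y)"
  using assms unfolding partials_def by blast+

lemma open_box:
  fixes S :: "(real \<times> real) set"
  assumes "open S" "(a,b) \<in> S"
  obtains r where "r > 0" "\<And>x y. \<bar>x - a\<bar> < r \<Longrightarrow> \<bar>y - b\<bar> < r \<Longrightarrow> (x,y) \<in> S"
proof -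
  obtain X Y where XY: "open X" "open Y" "a \<in> X" "b \<in> Y" "X \<times> Y \<subseteq> S"
    using open_prod_elim[OF assms] mem_Sigma_iff by metis
  obtain r1 r2 where "r1 > 0" "ball a r1 \<subseteq> X" "r2 > 0" "ball b r2 \<subseteq> Y"
    using XY by (meson open_contains_ball)
  then have "(x,y) \<in> S" if "\<bar>x - a\<bar> < min r1 r2" "\<bar>y - b\<bar> < min r1 r2" for x y
    using XY(5) that by (auto simp: subset_iff dist_real_def abs_minus_commute)
  then show ?thesis using that[of "min r1 r2"] \<open>r1 > 0\<close> \<open>r2 > 0\<close> by simp
qed

text \<open>\<open>partials\<close> carries the derivative functions as arguments, so that
  continuous extensions can stand in for \<open>deriv\<close>. The derivatives are two-sided, hence
  openness is what lets equality on \<open>S\<close> transfer them.\<close>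

lemma partials_cong:
  assumes S: "open S" and f: "partials S f fx fy"
    and eq: "\<And>p. p \<in> S \<Longrightarrow> f p = f' p" "\<And>p. p \<in> S \<Longrightarrow> fx p = fx' p" "\<And>p. p \<in> S \<Longrightarrow> fy p = fy' p"
  shows "partials S f' fx' fy'"
  unfolding partials_def
proof (intro allI impI conjI)
  fix x y assume p: "(x,y) \<in> S"
  obtain r where r: "r > 0" "\<And>s t. \<bar>s - x\<bar> < r \<Longrightarrow> \<bar>t - y\<bar> < r \<Longrightarrow> (s,t) \<in> S"
    using open_box[OF S p] by blast
  have "\<forall>\<^sub>F s in nhds x. f' (s,y) = f (s,y)"
    unfolding eventually_nhds_metric dist_real_def using r eq(1)[symmetric] by (intro exI[of _ r]) simp
  then show "((\<lambda>s. f' (s,y)) has_real_derivative fx' (x,y)) (at x)"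
    using partialsD(1)[OF f p] DERIV_cong_ev[OF refl, of "\<lambda>s. f' (s,y)" "\<lambda>s. f (s,y)"] eq(2)[OF p] by simp
  have "\<forall>\<^sub>F t in nhds y. f' (x,t) = f (x,t)"
    unfolding eventually_nhds_metric dist_real_def using r eq(1)[symmetric] by (intro exI[of _ r]) simp
  then show "((\<lambda>t. f' (x,t)) has_real_derivative fy' (x,y)) (at y)"
    using partialsD(2)[OF f p] DERIV_cong_ev[OF refl, of "\<lambda>t. f' (x,t)" "\<lambda>t. f (x,t)"] eq(3)[OF p] by simp
qed

lemma partials_unique:
  assumes "partials S f fx fy" "partials S f fx' fy'" "p \<in> S"
  shows "fx p = fx' p" "fy p = fy' p"
proof -
  obtain x y where p: "p = (x,y)" by fastforce
  show "fx p = fx' p" "fy p = fy' p"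
    using assms(3) unfolding p
    by (auto intro: DERIV_unique[OF partialsD(1)[OF assms(1)] partialsD(1)[OF assms(2)]]
      DERIV_unique[OF partialsD(2)[OF assms(1)] partialsD(2)[OF assms(2)]])
qed

lemma partials_subset: "partials S f fx fy \<Longrightarrow> T \<subseteq> S \<Longrightarrow> partials T f fx fy"
  unfolding partials_def by blast

lemma partials_add:
  "partials S f fx fy \<Longrightarrow> partials S h hx hy \<Longrightarrow>
   partials S (\<lambda>p. f p + h p) (\<lambda>p. fx p + hx p) (\<lambda>p. fy p + hy p)"
  unfolding partials_def by (auto intro!: DERIV_add)

lemma partials_diff:
  "partials S f fx fy \<Longrightarrow> partials S h hx hy \<Longrightarrow>
   partials S (\<lambda>p. f p - h p) (\<lambda>p. fx p - hx p) (\<lambda>p. fy p - hy p)"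
  unfolding partials_def by (auto intro!: DERIV_diff)

lemma partials_mult:
  "partials S f fx fy \<Longrightarrow> partials S h hx hy \<Longrightarrow>
   partials S (\<lambda>p. f p * h p) (\<lambda>p. fx p * h p + f p * hx p) (\<lambda>p. fy p * h p + f p * hy p)"
  unfolding partials_def by (auto intro!: derivative_eq_intros)

lemma partials_cmult:
  "partials S f fx fy \<Longrightarrow> partials S (\<lambda>p. k * f p) (\<lambda>p. k * fx p) (\<lambda>p. k * fy p)"
  unfolding partials_def by (auto intro!: DERIV_cmult)

lemma partials_compose:
  assumes "partials S f fx fy"
    and "\<And>p. p \<in> S \<Longrightarrow> (h has_real_derivative h' (f p)) (at (f p))"
  shows "partials S (\<lambda>p. h (f p)) (\<lambda>p. h' (f p) * fx p) (\<lambda>p. h' (f p) * fy p)"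
  unfolding partials_def
proof (intro allI impI conjI)
  fix x y assume p: "(x,y) \<in> S"
  show "((\<lambda>s. h (f (s,y))) has_real_derivative h' (f (x,y)) * fx (x,y)) (at x)"
    by (rule DERIV_chain2[OF assms(2)[OF p] partialsD(1)[OF assms(1) p]])
  show "((\<lambda>t. h (f (x,t))) has_real_derivative h' (f (x,y)) * fy (x,y)) (at y)"
    by (rule DERIV_chain2[OF assms(2)[OF p] partialsD(2)[OF assms(1) p]])
qed

text \<open>Continuity of one partial derivative, here the vertical one, together with existence of
  the other already gives total differentiability.\<close>

lemma partials_has_derivative:
  assumes S: "open S" and f: "partials S f fx fy" and cont: "continuous_on S fy" and p: "(a,b) \<in> S"
  shows "(f has_derivative (\<lambda>(h,k). h * fx (a,b) + k * fy (a,b))) (at (a,b))"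
proof -
  obtain r where r: "r > 0" "\<And>s t. \<bar>s - a\<bar> < r \<Longrightarrow> \<bar>t - b\<bar> < r \<Longrightarrow> (s,t) \<in> S"
    using open_box[OF S p] by blast
  let ?X = "{a-r<..<a+r}" and ?Y = "{b-r<..<b+r}"
  have XY: "(s,t) \<in> S" if "s \<in> ?X" "t \<in> ?Y" for s t
    using that r(2)[of s t] by (simp add: abs_less_iff)
  have sub: "?X \<times> ?Y \<subseteq> S" using XY by auto
  let ?fy = "\<lambda>x y. fy (x,y) *\<^sub>R (id_blinfun :: real \<Rightarrow>\<^sub>L real)"
  have "((\<lambda>(x,y). f (x,y)) has_derivative (\<lambda>(tx, ty). (\<lambda>h. h * fx (a,b)) tx + blinfun_apply (?fy a b) ty))
      (at (a,b) within ?X \<times> ?Y)"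
  proof (rule has_derivative_partialsI)
    have "((\<lambda>s. f (s,b)) has_derivative (\<lambda>h. h * fx (a,b))) (at a)"
      using partialsD(1)[OF f p] by (simp add: has_field_derivative_def mult.commute[of _ "fx (a,b)"])
    then show "((\<lambda>x. f (x, b)) has_derivative (\<lambda>h. h * fx (a,b))) (at a within ?X)"
      by (rule has_derivative_at_withinI)
    fix x y assume "x \<in> ?X" "y \<in> ?Y"
    then have "((\<lambda>t. f (x,t)) has_derivative (\<lambda>h. fy (x,y) * h)) (at y)"
      using partialsD(2)[OF f XY] by (simp add: has_field_derivative_def)
    then show "((\<lambda>y. f (x, y)) has_derivative blinfun_apply (?fy x y)) (at y within ?Y)"
      by (simp add: scaleR_blinfun.rep_eq has_derivative_at_withinI)
  next
    have "continuous (at (a,b) within ?X \<times> ?Y) fy"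
      using continuous_on_subset[OF cont sub] r(1) by (simp add: continuous_on_eq_continuous_within)
    then have "continuous (at (a,b) within ?X \<times> ?Y) (\<lambda>p. fy p *\<^sub>R (id_blinfun :: real \<Rightarrow>\<^sub>L real))"
      by (intro continuous_scaleR continuous_const)
    moreover have "(\<lambda>p. fy p *\<^sub>R (id_blinfun :: real \<Rightarrow>\<^sub>L real)) = (\<lambda>(x, y). ?fy x y)" by auto
    ultimately show "continuous (at (a, b) within ?X \<times> ?Y) (\<lambda>(x, y). ?fy x y)" by (simp only:)
  qed (use r in auto)
  moreover have "(\<lambda>(x,y). f (x,y)) = f"
    "(\<lambda>(tx, ty). (\<lambda>h. h * fx (a,b)) tx + blinfun_apply (?fy a b) ty) = (\<lambda>(h,k). h * fx (a,b) + k * fy (a,b))"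
    by (auto simp: fun_eq_iff scaleR_blinfun.rep_eq)
  ultimately have "(f has_derivative (\<lambda>(h,k). h * fx (a,b) + k * fy (a,b))) (at (a,b) within ?X \<times> ?Y)"
    by (simp only:)
  moreover have "open (?X \<times> ?Y)" "(a,b) \<in> ?X \<times> ?Y" using r by (auto intro: open_Times)
  ultimately show ?thesis using at_within_open by metis
qed

lemma partials_chain:
  assumes S: "open S" and f: "partials S f fx fy" and cont: "continuous_on S fy" and p: "(X t, Y t) \<in> S"
    and X: "(X has_real_derivative X') (at t)" and Y: "(Y has_real_derivative Y') (at t)"
  shows "((\<lambda>t. f (X t, Y t)) has_real_derivative fx (X t, Y t) * X' + fy (X t, Y t) * Y') (at t)"
proof -
  have "((\<lambda>t. (X t, Y t)) has_derivative (\<lambda>h. (X' * h, Y' * h))) (at t)"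
    using X Y unfolding has_field_derivative_def by (intro has_derivative_Pair)
  from has_derivative_compose[OF this partials_has_derivative[OF S f cont p]]
  show ?thesis unfolding has_field_derivative_def
    by (rule has_derivative_eq_rhs) (auto simp: algebra_simps)
qed

section \<open>Equality of mixed partial derivatives\<close>

lemma second_difference:
  assumes h: "h > 0" and f: "partials {(x,y). x \<in> {a..a+h} \<and> y \<in> {b..b+h}} f fx fy"
    and fx: "partials {(x,y). x \<in> {a..a+h} \<and> y \<in> {b..b+h}} fx fxx fxy"
  obtains x y where "a < x" "x < a + h" "b < y" "y < b + h"
    "f (a+h,b+h) - f (a+h,b) - f (a,b+h) + f (a,b) = h\<^sup>2 * fxy (x,y)"
proof -
  let ?F = "\<lambda>s. f (s,b+h) - f (s,b)"
  have "(?F has_real_derivative fx (s,b+h) - fx (s,b)) (at s)" if "a \<le> s" "s \<le> a+h" for s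
    by (intro DERIV_diff partialsD(1)[OF f]) (use that h in auto)
  from MVT2[of a "a+h" ?F, OF _ this] h
  obtain x where x: "a < x" "x < a+h" "?F (a+h) - ?F a = h * (fx (x,b+h) - fx (x,b))" by auto
  have "((\<lambda>t. fx (x,t)) has_real_derivative fxy (x,t)) (at t)" if "b \<le> t" "t \<le> b+h" for t
    by (intro partialsD(2)[OF fx]) (use that h x in auto)
  from MVT2[of b "b+h" "\<lambda>t. fx (x,t)", OF _ this] h
  obtain y where y: "b < y" "y < b+h" "fx (x,b+h) - fx (x,b) = h * fxy (x,y)" by auto
  show ?thesis using that[of x y] x y by (simp add: power2_eq_square algebra_simps)
qed

lemma partials_swap:
  assumes "partials S f fx fy"
  shows "partials (prod.swap ` S) (f \<circ> prod.swap) (fy \<circ> prod.swap) (fx \<circ> prod.swap)"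
  using assms unfolding partials_def by auto

text \<open>The second difference over a small square equals h^2 times either mixed derivative at
  some point of the square, according to the order in which the mean value theorem is applied. By
  continuity both are close to their values at the corner.\<close>

lemma mixed_partials_eq:
  assumes S: "open S" and f: "partials S f fx fy"
    and fx: "partials S fx fxx fxy" and fy: "partials S fy fyx fyy"
    and c: "continuous_on S fxy" "continuous_on S fyx" and p: "(a,b) \<in> S"
  shows "fxy (a,b) = fyx (a,b)"
proof (rule ccontr)
  assume ne: "fxy (a,b) \<noteq> fyx (a,b)"
  \<comment> \<open>Half the gap, so that the two values cannot meet within distance
    \<open>e\<close> of both.\<close>
  define e where "e = \<bar>fxy (a,b) - fyx (a,b)\<bar> / 2"
  have e: "e > 0" using ne by (simp add: e_def)
  have "\<exists>r>0. \<forall>x y. \<bar>x - a\<bar> < r \<longrightarrow> \<bar>y - b\<bar> < r \<longrightarrow> (x,y) \<in> S \<and> \<bar>F (x,y) - F (a,b)\<bar> < e"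
    if F: "continuous_on S F" for F
  proof -
    have "open (S \<inter> F -` ball (F (a,b)) e)"
      using continuous_open_preimage[OF F S] by simp
    from open_box[OF this, of a b] p e obtain r where
      "r > 0" "\<And>x y. \<bar>x - a\<bar> < r \<Longrightarrow> \<bar>y - b\<bar> < r \<Longrightarrow> (x,y) \<in> S \<inter> F -` ball (F (a,b)) e" by auto
    then show ?thesis by (intro exI[of _ r]) (auto simp: dist_real_def abs_minus_commute)
  qed
  from this[OF c(1)] this[OF c(2)] obtain r1 r2 where
    r1: "r1 > 0" "\<And>x y. \<bar>x - a\<bar> < r1 \<Longrightarrow> \<bar>y - b\<bar> < r1 \<Longrightarrow> (x,y) \<in> S \<and> \<bar>fxy (x,y) - fxy (a,b)\<bar> < e" and
    r2: "r2 > 0" "\<And>x y. \<bar>x - a\<bar> < r2 \<Longrightarrow> \<bar>y - b\<bar> < r2 \<Longrightarrow> (x,y) \<in> S \<and> \<bar>fyx (x,y) - fyx (a,b)\<bar> < e"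
    by blast
  define h where "h = min r1 r2 / 2"
  have h: "h > 0" "h < r1" "h < r2" using r1(1) r2(1) by (auto simp: h_def)
  let ?B = "{(x,y). x \<in> {a..a+h} \<and> y \<in> {b..b+h}}" and ?C = "{(y,x). y \<in> {b..b+h} \<and> x \<in> {a..a+h}}"
  have B: "?B \<subseteq> S" using r1(2) h by auto
  obtain x y where xy: "a < x" "x < a + h" "b < y" "y < b + h"
    "f (a+h,b+h) - f (a+h,b) - f (a,b+h) + f (a,b) = h\<^sup>2 * fxy (x,y)"
    using second_difference[OF h(1) partials_subset[OF f B] partials_subset[OF fx B]] by blast
  have sw: "prod.swap ` ?B = ?C" by (auto simp: image_iff)
  have "partials ?C (f \<circ> prod.swap) (fy \<circ> prod.swap) (fx \<circ> prod.swap)"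
    "partials ?C (fy \<circ> prod.swap) (fyy \<circ> prod.swap) (fyx \<circ> prod.swap)"
    using partials_swap[OF partials_subset[OF f B]] partials_swap[OF partials_subset[OF fy B]] unfolding sw by blast+
  from second_difference[OF h(1) this]
  obtain y' x' where xy': "b < y'" "y' < b + h" "a < x'" "x' < a + h"
    "f (a+h,b+h) - f (a,b+h) - f (a+h,b) + f (a,b) = h\<^sup>2 * fyx (x',y')"
    by (metis comp_apply swap_simp)
  have "h\<^sup>2 * fxy (x,y) = h\<^sup>2 * fyx (x',y')" using xy(5) xy'(5) by linarith
  then have "fxy (x,y) = fyx (x',y')" using h(1) by simp
  moreover have "\<bar>fxy (x,y) - fxy (a,b)\<bar> < e" using r1(2)[of x y] xy h by auto
  moreover have "\<bar>fyx (x',y') - fyx (a,b)\<bar> < e" using r2(2)[of x' y'] xy' h by auto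
  ultimately show False unfolding e_def by (auto simp: abs_if split: if_splits)
qed

section \<open>One-variable tests and the weak maximum principle\<close>

lemma even_deriv_zero:
  fixes f :: "real \<Rightarrow> real"
  assumes "(f has_real_derivative D) (at a)" "\<And>h. f (a - h) = f (a + h)"
  shows "D = 0"
proof -
  have "((\<lambda>h. f (a + h)) has_real_derivative D) (at 0)"
  proof -
    have "((\<lambda>h. a + h) has_real_derivative 1) (at 0)" by (auto intro!: derivative_eq_intros)
    from DERIV_chain2[of f D "\<lambda>h. a + h" 0, OF _ this] assms(1) show ?thesis by simp
  qed
  moreover have "((\<lambda>h. f (a + h)) has_real_derivative - D) (at 0)"
  proof -
    have "((\<lambda>h. a - h) has_real_derivative - 1) (at 0)" by (auto intro!: derivative_eq_intros)
    from DERIV_chain2[of f D "\<lambda>h. a - h" 0, OF _ this] assms(1) show ?thesis by (simp add: assms(2))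
  qed
  ultimately have "D = - D" by (rule DERIV_unique)
  then show "D = 0" by simp
qed

lemma second_derivative_local_max:
  fixes f :: "real \<Rightarrow> real"
  assumes r: "r > 0" and f: "\<And>y. \<bar>y - x\<bar> < r \<Longrightarrow> (f has_real_derivative f' y) (at y)"
    and f': "(f' has_real_derivative l) (at x)"
    and max: "\<And>y. \<bar>y - x\<bar> < r \<Longrightarrow> f y \<le> f x"
  shows "l \<le> 0"
proof (rule ccontr)
  assume "\<not> l \<le> 0"
  then have l: "l > 0" by simp
  have "f' x = 0"
    using DERIV_local_max[of f "f' x" x r] f[of x] r max by (auto simp: abs_minus_commute)
  moreover obtain e where e: "e > 0" "\<And>h. 0 < h \<Longrightarrow> h < e \<Longrightarrow> f' x < f' (x + h)"
    using DERIV_pos_inc_right[OF f' l] by blast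
  define h where "h = min e r / 2"
  have h: "0 < h" "h < e" "h < r" using e r by (auto simp: h_def)
  have "(f has_real_derivative f' s) (at s)" if "x \<le> s" "s \<le> x + h" for s
    using f[of s] that h by auto
  from MVT2[of x "x+h" f, OF _ this] h obtain z where
    z: "x < z" "z < x + h" "f (x+h) - f x = h * f' z" by auto
  have "f' z > 0" using e(2)[of "z - x"] z h \<open>f' x = 0\<close> by auto
  then have "h * f' z > 0" using h by simp
  then show False using z(3) max[of "x+h"] h by auto
qed

text \<open>Adding a small multiple of x^2 makes the Laplacian strictly positive, which the second
  derivative test forbids at an interior maximum. The sign of the Laplacian is asked for only where
  f > M; this accommodates zero-order terms whose sign is favorable only there.\<close>

lemma weak_maximum_principle:
  fixes f :: "real \<times> real \<Rightarrow> real"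
  assumes K: "compact K" and S: "open S" "S \<subseteq> K" and cont: "continuous_on K f"
    and f: "partials S f fx fy" and fx: "partials S fx fxx fxy" and fy: "partials S fy fyx fyy"
    and bd: "\<And>p. p \<in> K \<Longrightarrow> p \<notin> S \<Longrightarrow> f p \<le> M"
    and sub: "\<And>p. p \<in> S \<Longrightarrow> f p > M \<Longrightarrow> fxx p + fyy p \<ge> 0"
    and p: "p \<in> K"
  shows "f p \<le> M"
proof (rule ccontr)
  assume "\<not> f p \<le> M"
  then have pM: "f p > M" by simp
  obtain B where B: "B > 0" "\<And>q. q \<in> K \<Longrightarrow> (fst q)\<^sup>2 \<le> B"
  proof -
    obtain b where b: "\<And>q. q \<in> K \<Longrightarrow> norm q \<le> b" using compact_imp_bounded[OF K] bounded_iff by metis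
    have "(fst q)\<^sup>2 \<le> \<bar>b\<bar>\<^sup>2 + 1" if "q \<in> K" for q
    proof -
      have "\<bar>fst q\<bar> \<le> \<bar>b\<bar>" using norm_fst_le[of "fst q" "snd q"] b[OF that] by simp
      then have "\<bar>fst q\<bar>\<^sup>2 \<le> \<bar>b\<bar>\<^sup>2" by (intro power_mono) auto
      then show ?thesis by simp
    qed
    then show ?thesis by (intro that[of "\<bar>b\<bar>\<^sup>2 + 1"]) (auto simp: add_pos_nonneg add_nonneg_pos)
  qed
  \<comment> \<open>With this choice the perturbation stays below half of f p - M on
    \<open>K\<close>, so the maximum point of the perturbed function still has f > M and must lie in
    \<open>S\<close>.\<close>
  define \<epsilon> where "\<epsilon> = (f p - M) / (2 * B)"
  have \<epsilon>: "\<epsilon> > 0" "\<epsilon> * B < f p - M" using pM B by (auto simp: \<epsilon>_def field_simps)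
  let ?h = "\<lambda>q. f q + \<epsilon> * (fst q)\<^sup>2"
  have "continuous_on K ?h" using cont by (intro continuous_intros)
  with continuous_attains_sup[OF K _ this] p obtain q where q: "q \<in> K" "\<And>z. z \<in> K \<Longrightarrow> ?h z \<le> ?h q" by blast
  obtain a b where ab: "q = (a,b)" by fastforce
  have "\<epsilon> * (fst q)\<^sup>2 \<le> \<epsilon> * B" using B(2)[OF q(1)] \<epsilon> by simp
  moreover have "f p \<le> ?h p" using \<epsilon> by simp
  ultimately have fq: "f q > M" using q(2)[OF p] \<epsilon>(2) by linarith
  then have qS: "(a,b) \<in> S" using bd q(1) ab by fastforce
  obtain r where r: "r > 0" "\<And>s t. \<bar>s - a\<bar> < r \<Longrightarrow> \<bar>t - b\<bar> < r \<Longrightarrow> (s,t) \<in> S"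
    using open_box[OF S(1) qS] by blast
  have "fxx (a,b) + 2 * \<epsilon> \<le> 0"
  proof (rule second_derivative_local_max[OF r(1), where f = "\<lambda>s. ?h (s,b)" and f' = "\<lambda>s. fx (s,b) + 2 * \<epsilon> * s"])
    show "((\<lambda>s. ?h (s,b)) has_real_derivative fx (y,b) + 2 * \<epsilon> * y) (at y)" if "\<bar>y - a\<bar> < r" for y
      using partialsD(1)[OF f r(2)[OF that, of b]] r(1) by (auto intro!: derivative_eq_intros)
    show "((\<lambda>s. fx (s,b) + 2 * \<epsilon> * s) has_real_derivative fxx (a,b) + 2 * \<epsilon>) (at a)"
      using partialsD(1)[OF fx qS] by (auto intro!: derivative_eq_intros)
    show "?h (y,b) \<le> ?h (a,b)" if "\<bar>y - a\<bar> < r" for y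
      using q(2)[of "(y,b)"] r(2)[OF that, of b] r(1) S(2) ab by auto
  qed
  moreover have "fyy (a,b) \<le> 0"
  proof (rule second_derivative_local_max[OF r(1), where f = "\<lambda>t. ?h (a,t)" and f' = "\<lambda>t. fy (a,t)"])
    show "((\<lambda>t. ?h (a,t)) has_real_derivative fy (a,y)) (at y)" if "\<bar>y - b\<bar> < r" for y
      using partialsD(2)[OF f r(2)[OF _ that, of a]] r(1) by (auto intro!: derivative_eq_intros)
    show "((\<lambda>t. fy (a,t)) has_real_derivative fyy (a,b)) (at b)" by (rule partialsD(2)[OF fy qS])
    show "?h (a,y) \<le> ?h (a,b)" if "\<bar>y - b\<bar> < r" for y
      using q(2)[of "(a,y)"] r(2)[OF _ that, of a] r(1) S(2) ab by auto
  qed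
  ultimately show False using sub[OF qS] fq ab \<epsilon>(1) by auto
qed

section \<open>Smooth functions on a strip up to the boundary\<close>

lemma Ck_on_pdx_pdy_funpow:
  "Ck_on (k + i + j) S f \<Longrightarrow> Ck_on k S ((pdx ^^ i) ((pdy ^^ j) f))"
proof (induction i arbitrary: k)
  case 0
  then show ?case
  proof (induction j arbitrary: k)
    case (Suc j)
    have "Ck_on (Suc k) S ((pdy ^^ j) f)" using Suc.IH[of "Suc k"] Suc.prems by simp
    then show ?case by simp
  qed simp
next
  case (Suc i)
  have "Ck_on (Suc k) S ((pdx ^^ i) ((pdy ^^ j) f))" using Suc.IH[of "Suc k"] Suc.prems by simp
  then show ?case by simp
qed

lemma Ck_on_continuous: "Ck_on k S f \<Longrightarrow> continuous_on S f"
  by (cases k) auto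

lemma Ck_on_mono: "Ck_on (n + m) S f \<Longrightarrow> Ck_on n S f"
proof (induction n arbitrary: f)
  case 0
  then show ?case using Ck_on_continuous by auto
qed auto

lemma Ck_on_partials: "Ck_on (Suc k) S f \<Longrightarrow> partials S f (pdx f) (pdy f)"
  unfolding partials_def pdx_def pdy_def
  by (auto simp: DERIV_deriv_iff_real_differentiable)

text \<open>\<open>Ck_closure\<close> lists derivatives with every \<open>pdx\<close> outside every
  \<open>pdy\<close>. A further y-derivative must therefore be moved inside past i x-derivatives,
  one application of the symmetry of mixed partials at a time.\<close>

lemma Ck_on_partials_funpow:
  assumes S: "open S"
  shows "Ck_on (Suc i) S F \<Longrightarrow> partials S ((pdx ^^ i) F) ((pdx ^^ Suc i) F) ((pdx ^^ i) (pdy F))"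
proof (induction i)
  case 0
  then show ?case by (simp del: Ck_on.simps add: Ck_on_partials)
next
  case (Suc i)
  let ?A = "(pdx ^^ i) F" and ?B = "(pdx ^^ i) (pdy F)"
  have F: "Ck_on (Suc (Suc i)) S F" by (rule Suc.prems)
  have CA: "Ck_on 2 S ?A" using Ck_on_pdx_pdy_funpow[of 2 i 0 S F] F by (simp add: numeral_2_eq_2 del: Ck_on.simps)
  have CB: "Ck_on 1 S ?B"
    using Ck_on_pdx_pdy_funpow[of 1 i 1 S F] F by (simp del: Ck_on.simps)
  have A1: "Ck_on 1 S (pdx ?A)" using CA by (simp add: numeral_2_eq_2)
  have pA: "partials S ?A (pdx ?A) ?B"
    using Suc.IH Ck_on_mono[of "Suc i" 1 S F] F by (simp del: Ck_on.simps)
  have pA1: "partials S (pdx ?A) (pdx (pdx ?A)) (pdy (pdx ?A))"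
    using Ck_on_partials[of 0 S "pdx ?A"] A1 by (simp only: One_nat_def)
  have pB: "partials S ?B (pdx ?B) (pdy ?B)" using Ck_on_partials[of 0 S ?B] CB by (simp only: One_nat_def)
  have "continuous_on S (pdy (pdx ?A))" "continuous_on S (pdx ?B)"
    using A1 CB by (simp_all add: One_nat_def)
  then have "pdy (pdx ?A) p = pdx ?B p" if "p \<in> S" for p
    using mixed_partials_eq[OF S pA pA1 pB] that by (cases p) auto
  then show ?case using partials_cong[OF S pA1] by simp
qed

lemma Ck_closure_extension:
  assumes S: "open S" and f: "Ck_closure k S f"
  obtains h :: "nat \<Rightarrow> nat \<Rightarrow> real \<times> real \<Rightarrow> real" where "h 0 0 = f"
    "\<And>i j. i + j \<le> k \<Longrightarrow> continuous_on (closure S) (h i j)"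
    "\<And>i j. i + j < k \<Longrightarrow> partials S (h i j) (h (Suc i) j) (h i (Suc j))"
    "\<And>i j p. i + j \<le> k \<Longrightarrow> p \<in> S \<Longrightarrow> h i j p = (pdx ^^ i) ((pdy ^^ j) f) p"
proof -
  have "\<exists>h. continuous_on (closure S) h \<and> (\<forall>p\<in>S. h p = (pdx ^^ i) ((pdy ^^ j) f) p)" if "i + j \<le> k" for i j
    using f that unfolding Ck_closure_def by blast
  then obtain h0 where h0: "\<And>i j. i + j \<le> k \<Longrightarrow> continuous_on (closure S) (h0 i j)"
    "\<And>i j p. i + j \<le> k \<Longrightarrow> p \<in> S \<Longrightarrow> h0 i j p = (pdx ^^ i) ((pdy ^^ j) f) p"
    by metis
  \<comment> \<open>The entry (0,0) is overridden by \<open>f\<close> itself, so that its boundary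
    values are those in the boundary conditions and \<open>h 0 0 = f\<close> holds as
    functions.\<close>
  define h where "h = (\<lambda>i j. if i = 0 \<and> j = 0 then f else h0 i j)"
  have c: "continuous_on (closure S) (h i j)" if "i + j \<le> k" for i j
    using h0(1)[OF that] f by (auto simp: h_def Ck_closure_def)
  have e: "h i j p = (pdx ^^ i) ((pdy ^^ j) f) p" if "i + j \<le> k" "p \<in> S" for i j p
    using h0(2)[OF that] by (auto simp: h_def)
  have "partials S (h i j) (h (Suc i) j) (h i (Suc j))" if ij: "i + j < k" for i j
  proof -
    have "Ck_on k S f" using f by (simp add: Ck_closure_def)
    then have "Ck_on (Suc i + (k - j - Suc i)) S ((pdy ^^ j) f)"
      using Ck_on_pdx_pdy_funpow[of "k - j" 0 j S f] ij by (simp del: Ck_on.simps add: Suc_diff_Suc)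
    then have "Ck_on (Suc i) S ((pdy ^^ j) f)" by (rule Ck_on_mono)
    from Ck_on_partials_funpow[OF S this] show ?thesis
      by (rule partials_cong[OF S]) (use e ij in auto)
  qed
  with c e show ?thesis by (intro that[of h]) (auto simp: h_def)
qed

section \<open>The fluid strip and differentiation along its upper boundary\<close>

definition strip :: "real \<Rightarrow> (real \<Rightarrow> real) \<Rightarrow> (real \<times> real) set" where
  "strip d \<eta> = {(x,y). - d < y \<and> y < \<eta> x}"

lemma mem_strip: "(x,y) \<in> strip d \<eta> \<longleftrightarrow> - d < y \<and> y < \<eta> x"
  by (simp add: strip_def)

lemma open_strip:
  assumes "continuous_on UNIV \<eta>"
  shows "open (strip d \<eta>)"
proof -
  have "strip d \<eta> = {p. - d < snd p} \<inter> {p. snd p < \<eta> (fst p)}" by (auto simp: strip_def)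
  moreover have "continuous_on UNIV (\<lambda>p::real\<times>real. \<eta> (fst p))"
    by (rule continuous_on_compose2[OF assms]) (auto intro: continuous_intros)
  ultimately show ?thesis by (auto intro!: open_Int open_Collect_less continuous_intros)
qed

lemma closure_strip:
  assumes c: "continuous_on UNIV \<eta>" and d: "\<And>x. - d < \<eta> x"
  shows "closure (strip d \<eta>) = {(x,y). - d \<le> y \<and> y \<le> \<eta> x}"
proof (rule antisym)
  have "{(x,y). - d \<le> y \<and> y \<le> \<eta> x} = {p. - d \<le> snd p} \<inter> {p. snd p \<le> \<eta> (fst p)}" by auto
  moreover have "continuous_on UNIV (\<lambda>p::real\<times>real. \<eta> (fst p))"
    by (rule continuous_on_compose2[OF c]) (auto intro: continuous_intros)
  ultimately have "closed {(x,y). - d \<le> y \<and> y \<le> \<eta> x}"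
    by (auto intro!: closed_Int closed_Collect_le continuous_intros)
  then show "closure (strip d \<eta>) \<subseteq> {(x,y). - d \<le> y \<and> y \<le> \<eta> x}"
    by (rule closure_minimal[rotated]) (auto simp: strip_def)
  show "{(x,y). - d \<le> y \<and> y \<le> \<eta> x} \<subseteq> closure (strip d \<eta>)"
  proof safe
    fix x y assume y: "- d \<le> y" "y \<le> \<eta> x"
    have "y \<in> closure {- d<..<\<eta> x}" using y d[of x] by simp
    then have "(x,y) \<in> closure ({x} \<times> {- d<..<\<eta> x})" unfolding closure_Times by simp
    then show "(x,y) \<in> closure (strip d \<eta>)"
      by (rule rev_subsetD) (auto intro!: closure_mono simp: strip_def)
  qed
qed

text \<open>\<open>F\<close> is differentiable only below the curve. The curve is lowered by
  \<epsilon>, where the interior chain rule bounds the error of the linear approximation by e |x -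
  a| uniformly in \<epsilon>; continuity of \<open>F\<close> up to the boundary then permits
  \<epsilon> to tend to 0.\<close>

lemma surface_has_derivative:
  assumes d: "\<And>x. - d < \<eta> x" and \<eta>: "\<And>x. (\<eta> has_real_derivative \<eta>' x) (at x)"
    and c\<eta>': "continuous_on UNIV \<eta>'"
    and F: "partials (strip d \<eta>) F Fx Fy"
    and cF: "continuous_on (closure (strip d \<eta>)) F"
    and cFx: "continuous_on (closure (strip d \<eta>)) Fx" and cFy: "continuous_on (closure (strip d \<eta>)) Fy"
  shows "((\<lambda>x. F (x, \<eta> x)) has_real_derivative Fx (a, \<eta> a) + \<eta>' a * Fy (a, \<eta> a)) (at a)"
proof -
  let ?S = "strip d \<eta>"
  have c\<eta>: "continuous_on UNIV \<eta>" using \<eta> by (meson DERIV_isCont continuous_at_imp_continuous_on)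
  note S = open_strip[OF c\<eta>, of d] and C = closure_strip[OF c\<eta> d]
  define D where "D = Fx (a, \<eta> a) + \<eta>' a * Fy (a, \<eta> a)"
  have "continuous_on (closure ?S) (\<lambda>p. Fx p + \<eta>' (fst p) * Fy p)"
    by (intro continuous_on_add continuous_on_mult cFx cFy continuous_on_compose2[OF c\<eta>'] continuous_on_fst continuous_on_id) auto
  then have cont: "continuous_on (closure ?S) (\<lambda>p. Fx p + \<eta>' (fst p) * Fy p - D)"
    by (intro continuous_on_diff continuous_on_const)
  have "\<exists>r>0. \<forall>x. \<bar>x - a\<bar> < r \<longrightarrow> \<bar>F (x, \<eta> x) - F (a, \<eta> a) - D * (x - a)\<bar> \<le> e * \<bar>x - a\<bar>" if e: "e > 0" for e
  proof -
    have "(a, \<eta> a) \<in> closure ?S" using d[of a] unfolding C by auto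
    then obtain r1 where r1: "r1 > 0"
      "\<And>p. p \<in> closure ?S \<Longrightarrow> dist p (a, \<eta> a) < r1 \<Longrightarrow> \<bar>Fx p + \<eta>' (fst p) * Fy p - D\<bar> < e"
      using cont e unfolding continuous_on_iff dist_real_def D_def by fastforce
    have "isCont \<eta> a" using \<eta> by (rule DERIV_isCont)
    \<comment> \<open>Three contributions below r1/3 (horizontal distance, variation of \<eta>,
      shift) keep the lowered curve within r1 of the base point. Two contributions below (\<eta> a +
      d)/2 keep it above the bottom.\<close>
    then obtain r2 where r2: "r2 > 0" "\<And>x. \<bar>x - a\<bar> < r2 \<Longrightarrow> \<bar>\<eta> x - \<eta> a\<bar> < min (r1/3) ((\<eta> a + d)/2)"
      unfolding continuous_at_eps_delta dist_real_def using r1(1) d[of a]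
      by (metis add.commute diff_minus_eq_add diff_gt_0_iff_gt half_gt_zero min_less_iff_conj zero_less_divide_iff zero_less_numeral)
    define r where "r = min r2 (r1/3)"
    have r: "r > 0" using r1(1) r2(1) by (simp add: r_def)
    have "\<bar>F (x, \<eta> x) - F (a, \<eta> a) - D * (x - a)\<bar> \<le> e * \<bar>x - a\<bar>" if x: "\<bar>x - a\<bar> < r" for x
    proof -
      have shifted: "\<bar>F (x, \<eta> x - \<epsilon>) - F (a, \<eta> a - \<epsilon>) - D * (x - a)\<bar> \<le> e * \<bar>x - a\<bar>"
        if \<epsilon>: "0 < \<epsilon>" "\<epsilon> < min (r1/3) ((\<eta> a + d)/2)" for \<epsilon>
      proof -
        let ?G = "\<lambda>t. F (t, \<eta> t - \<epsilon>) - D * t"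
        let ?g = "\<lambda>t. Fx (t, \<eta> t - \<epsilon>) + \<eta>' t * Fy (t, \<eta> t - \<epsilon>) - D"
        have near: "(t, \<eta> t - \<epsilon>) \<in> ?S" "\<bar>?g t\<bar> < e" if t: "\<bar>t - a\<bar> < r" for t
        proof -
          have t2: "\<bar>\<eta> t - \<eta> a\<bar> < min (r1/3) ((\<eta> a + d)/2)" using r2(2) t by (simp add: r_def)
          show in_S: "(t, \<eta> t - \<epsilon>) \<in> ?S" using t2 \<epsilon> unfolding mem_strip by (auto simp: abs_if split: if_splits)
          have "dist (t, \<eta> t - \<epsilon>) (a, \<eta> a) \<le> \<bar>t - a\<bar> + \<bar>\<eta> t - \<epsilon> - \<eta> a\<bar>"
            unfolding dist_prod_def dist_real_def using sqrt_sum_squares_le_sum_abs by simp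
          also have "\<dots> < r1" using t t2 \<epsilon> by (auto simp: r_def abs_if split: if_splits)
          finally show "\<bar>?g t\<bar> < e" using r1(2)[of "(t, \<eta> t - \<epsilon>)"] in_S closure_subset by fastforce
        qed
        have der: "(?G has_real_derivative ?g t) (at t)" if t: "\<bar>t - a\<bar> < r" for t
        proof -
          have "continuous_on ?S Fy" using cFy closure_subset continuous_on_subset by blast
          from partials_chain[where X = "\<lambda>t. t" and Y = "\<lambda>t. \<eta> t - \<epsilon>", OF S F this near(1)[OF t], of 1 "\<eta>' t"]
          have "((\<lambda>t. F (t, \<eta> t - \<epsilon>)) has_real_derivative Fx (t, \<eta> t - \<epsilon>) * 1 + Fy (t, \<eta> t - \<epsilon>) * \<eta>' t) (at t)"
            using DERIV_diff[OF \<eta>[of t] DERIV_const[of \<epsilon>]] by simp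
          then show ?thesis by (auto intro!: derivative_eq_intros)
        qed
        have "norm (?G x - ?G a) \<le> e * norm (x - a)"
        proof (rule field_differentiable_bound[of "{t. \<bar>t - a\<bar> < r}" ?G ?g])
          have "{t. \<bar>t - a\<bar> < r} = ball a r" by (auto simp: dist_real_def)
          then show "convex {t. \<bar>t - a\<bar> < r}" by simp
        qed (use der near x r in \<open>auto intro: has_field_derivative_at_within less_imp_le\<close>)
        then show ?thesis by (simp add: algebra_simps)
      qed
      have lim: "((\<lambda>\<epsilon>. F (z, \<eta> z - \<epsilon>)) \<longlongrightarrow> F (z, \<eta> z)) (at_right 0)" for z
      proof -
        have "continuous_on {0..\<eta> z + d} (\<lambda>\<epsilon>. F (z, \<eta> z - \<epsilon>))"
          using d[of z] by (intro continuous_on_compose2[OF cF] continuous_intros) (auto simp: C)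
        then have "((\<lambda>\<epsilon>. F (z, \<eta> z - \<epsilon>)) \<longlongrightarrow> F (z, \<eta> z - 0)) (at 0 within {0..\<eta> z + d})"
          using d[of z] unfolding continuous_on_def by force
        then show ?thesis using at_within_Icc_at_right[of 0 "\<eta> z + d"] d[of z] by simp
      qed
      have "((\<lambda>\<epsilon>. \<bar>F (x, \<eta> x - \<epsilon>) - F (a, \<eta> a - \<epsilon>) - D * (x - a)\<bar>) \<longlongrightarrow>
          \<bar>F (x, \<eta> x) - F (a, \<eta> a) - D * (x - a)\<bar>) (at_right 0)"
        by (intro tendsto_intros lim)
      moreover have "\<forall>\<^sub>F \<epsilon> in at_right 0. \<bar>F (x, \<eta> x - \<epsilon>) - F (a, \<eta> a - \<epsilon>) - D * (x - a)\<bar> \<le> e * \<bar>x - a\<bar>"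
        using shifted r1(1) d[of a]
        by (intro eventually_at_rightI[of 0 "min (r1/3) ((\<eta> a + d)/2)"]) auto
      ultimately show ?thesis by (rule tendsto_upperbound) simp
    qed
    with r show ?thesis by blast
  qed
  then have "((\<lambda>x. F (x, \<eta> x)) has_derivative (*) D) (at a)"
    unfolding has_derivative_within_alt by (auto simp: bounded_linear_mult_right)
  then show ?thesis unfolding has_field_derivative_def D_def .
qed

section \<open>The quadratic form at a critical surface point\<close>

text \<open>This is \<open>slope_form\<close> at c = g/v, divided by v^3, with s = w/v. It is
  positive definite in (a,b) because its discriminant is negative.\<close>

lemma quartic_form_pos:
  fixes s a b :: real
  assumes s: "0 < s" "s < 1" and ab: "a \<noteq> 0 \<or> b \<noteq> 0"
  shows "(2 - 3 * s + 6 * s^2 + 2 * s^3 + s^5) * a^2 + (1 - 3 * s - 4 * s^2 + s^3 - s^4) * a * b + (1 + s) * b^2 > 0"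
proof -
  define A B E where "A = 2 - 3 * s + 6 * s^2 + 2 * s^3 + s^5" and "B = 1 + s" and "E = 1 - 3 * s - 4 * s^2 + s^3 - s^4"
  \<comment> \<open>Only s^6 and s^8 enter the discriminant below with negative coefficients. They
    cost at most 5 + 1, less than the constant term 7.\<close>
  have p: "s^6 \<le> 1" "s^8 \<le> 1" using s by (auto intro: power_le_one)
  have "4 * A * B - E^2 = 7 + 2 * s + 11 * s^2 + 6 * s^3 + 6 * s^5 - 5 * s^6 + 2 * s^7 - s^8"
    unfolding A_def B_def E_def by algebra
  moreover have "s^2 > 0" "s^3 > 0" "s^5 > 0" "s^7 > 0" using s by auto
  ultimately have disc: "4 * A * B - E^2 > 0" using p s by linarith
  have B: "B > 0" using s by (simp add: B_def)
  have "4 * B * (A * a^2 + E * a * b + B * b^2) = (2 * B * b + E * a)^2 + (4 * A * B - E^2) * a^2" by algebra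
  also have "\<dots> > 0"
  proof (cases "a = 0")
    case True
    then show ?thesis using ab B by simp
  next
    case False
    then have "(4 * A * B - E^2) * a^2 > 0" using disc by simp
    then show ?thesis by (simp add: add_nonneg_pos)
  qed
  finally have "A * a^2 + E * a * b + B * b^2 > 0" using B by (simp add: zero_less_mult_iff)
  then show ?thesis unfolding A_def B_def E_def .
qed

text \<open>With w = -u, a = u_x, b = u_y + v_x and c = -\<gamma>(0), this is the part of 2 u v
  times the differentiated surface identity that is free of u_xy and \<gamma>', after g has been
  eliminated.\<close>

definition slope_form :: "real \<Rightarrow> real \<Rightarrow> real \<Rightarrow> real \<Rightarrow> real \<Rightarrow> real" where
  "slope_form w v a b c =
     2 * v * (3 * w^2 + v^2) * a^2 + v^3 * b^2 + v^3 * c * b + w * a * ((w^2 - 3 * v^2) * b - (w^2 + 3 * v^2) * c)"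

text \<open>The form is affine in \<open>c\<close>, so positivity is checked at \<open>c = 0\<close> and at \<open>c = b\<close>
  if \<open>v \<le> w\<close>, at \<open>c = g / v\<close> otherwise.\<close>

lemma slope_form_pos_irrotational:
  assumes w: "w > 0" and v: "v > 0" and a: "a \<ge> 0" and ab: "a \<noteq> 0 \<or> b \<noteq> 0"
    and b: "w^2 \<ge> 3 * v^2 \<Longrightarrow> b > 0"
  shows "slope_form w v a b 0 > 0"
proof (cases "w^2 \<ge> 3 * v^2")
  case True
  then have "v^3 * b^2 > 0" "w * a * ((w^2 - 3 * v^2) * b) \<ge> 0" "2 * v * (3 * w^2 + v^2) * a^2 \<ge> 0" using w v a b by auto
  then show ?thesis unfolding slope_form_def by (simp only: mult_zero_right add_0_right diff_zero mult_zero_left)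
next
  case False
  define k where "k = w * (3 * v^2 - w^2)"
  have k: "k \<ge> 0" using False w by (simp add: k_def)
  \<comment> \<open>This factorization yields k <= 2 v^3, with equality at w = v. The cross term is
    then dominated through 2 |a b| < 2 a^2 + b^2.\<close>
  have "(2 * v^3)^2 - k^2 = (v^2 - w^2)^2 * (4 * v^2 - w^2)" unfolding k_def by algebra
  moreover have "4 * v^2 - w^2 \<ge> 0" using False v by (smt (verit) zero_le_power2)
  ultimately have "k^2 \<le> (2 * v^3)^2" by (smt (verit) mult_nonneg_nonneg zero_le_power2)
  then have k2: "k \<le> 2 * v^3" using v by (smt (verit) power2_le_imp_le zero_less_power)
  have eq: "slope_form w v a b 0 = 6 * v * w^2 * a^2 + (v^3 * (2 * a^2 + b^2) - k * (a * b))"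
    unfolding slope_form_def k_def by algebra
  have "k * (a * b) \<le> k * \<bar>a * b\<bar>" using k by (intro mult_left_mono) auto
  also have "\<dots> \<le> 2 * v^3 * \<bar>a * b\<bar>" using k2 by (intro mult_right_mono) auto
  finally have "k * (a * b) \<le> v^3 * (2 * \<bar>a * b\<bar>)" by simp
  moreover have "2 * \<bar>a * b\<bar> < 2 * a^2 + b^2"
  proof -
    have "2 * \<bar>a * b\<bar> = 2 * a^2 + b^2 - ((\<bar>b\<bar> - \<bar>a\<bar>)^2 + a^2)"
      by (simp add: abs_mult power2_eq_square algebra_simps)
    moreover have "(\<bar>b\<bar> - \<bar>a\<bar>)^2 + a^2 > 0" using ab by (auto simp: sum_power2_gt_zero_iff)
    ultimately show ?thesis by linarith
  qed
  then have "v^3 * (2 * \<bar>a * b\<bar>) < v^3 * (2 * a^2 + b^2)" using v by simp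
  ultimately have "v^3 * (2 * a^2 + b^2) - k * (a * b) > 0" by linarith
  moreover have "6 * v * w^2 * a^2 \<ge> 0" using v by simp
  ultimately show ?thesis unfolding eq by linarith
qed

text \<open>\<open>rel\<close> is the surface identity. For v <= w it gives w v b >= g v >= c w v,
  hence b > 0 and 0 <= c <= b. For v > w the sign of b is unknown, and c <= g/v takes over.\<close>

lemma slope_form_pos:
  assumes w: "w > 0" and v: "v > 0" and a: "a \<ge> 0" and c: "c \<ge> 0" and g: "g > 0"
    and rel: "w * v * b = g * v + (w^2 - v^2) * a" and cw: "c * w \<le> g" and cv: "c * v \<le> g"
  shows "slope_form w v a b c > 0"
proof -
  have ab: "a \<noteq> 0 \<or> b \<noteq> 0" using rel g v by auto
  have bpos: "b > 0" if "v \<le> w"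
  proof -
    have "v^2 \<le> w^2" using that v by (simp add: power_mono)
    then have "(w^2 - v^2) * a \<ge> 0" using a by simp
    moreover have "g * v > 0" using g v by simp
    ultimately have "w * v * b > 0" using rel by linarith
    then show ?thesis using zero_less_mult_pos[of "w * v" b] w v by simp
  qed
  have Q0: "slope_form w v a b 0 > 0"
  proof (rule slope_form_pos_irrotational[OF w v a ab])
    assume "3 * v^2 \<le> w^2"
    then have "v^2 \<le> w^2" by (smt (verit) zero_le_power2)
    then show "b > 0" using bpos w by (simp add: power2_le_iff_abs_le v)
  qed
  show ?thesis
  proof (cases "v \<le> w")
    case True
    note b = bpos[OF True]
    have "v^2 \<le> w^2" using True v by (simp add: power_mono)
    then have "(w^2 - v^2) * a \<ge> 0" using a by simp
    then have "c * w * v \<le> b * (w * v)" using rel cw v by (smt (verit) mult_right_mono mult.commute)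
    then have cb: "c \<le> b" using w v by (simp add: mult.assoc)
    \<comment> \<open>At c = b the terms in w^3 cancel, and the remaining cross term -6 w v^2 a b is
      absorbed by a square.\<close>
    have "slope_form w v a b b = 2 * v * (v^2 * a^2 + 3 * (w * a - v * b/2)^2 + v^2 * b^2/4)"
      unfolding slope_form_def by (simp add: field_simps power2_eq_square power3_eq_cube)
    moreover have "v^2 * b^2/4 > 0" using v b by simp
    ultimately have Qb: "slope_form w v a b b > 0" using v
      by (simp add: add_nonneg_pos)
    have "b * slope_form w v a b c = (b - c) * slope_form w v a b 0 + c * slope_form w v a b b"
      unfolding slope_form_def by algebra
    also have "\<dots> > 0"
      using Q0 Qb cb c b by (cases "c = 0") (auto intro: add_nonneg_pos)
    finally show ?thesis using b by (simp add: zero_less_mult_iff)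
  next
    case False
    define s where "s = w / v"
    have s: "0 < s" "s < 1" "w = s * v" using False w v by (auto simp: s_def)
    \<comment> \<open>Solving \<open>rel\<close> for g makes the end value g/v linear in a and b, so
      the form there depends on a, b and the ratio s alone, up to the factor v^3.\<close>
    have gv: "g = s * v * b + (1 - s^2) * v * a"
    proof -
      have "v * g = v * (s * v * b + (1 - s^2) * v * a)" using rel unfolding s(3) by algebra
      then show ?thesis using v by simp
    qed
    have "slope_form w v a b (g/v) =
        v^3 * ((2 - 3 * s + 6 * s^2 + 2 * s^3 + s^5) * a^2 + (1 - 3 * s - 4 * s^2 + s^3 - s^4) * a * b + (1 + s) * b^2)"
    proof -
      have "g/v = s * b + (1 - s^2) * a" using gv v by (simp add: field_simps)
      then show ?thesis unfolding slope_form_def s(3) by algebra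
    qed
    then have Qg: "slope_form w v a b (g/v) > 0" using quartic_form_pos[OF s(1,2) ab] v by simp
    have "g * slope_form w v a b c = (g - c * v) * slope_form w v a b 0 + c * v * slope_form w v a b (g/v)"
      unfolding slope_form_def using v by (simp add: field_simps)
    also have "\<dots> > 0"
      using Q0 Qg cv c g v by (cases "c = 0") (auto intro: add_nonneg_pos)
    finally show ?thesis using g by (simp add: zero_less_mult_iff)
  qed
qed

text \<open>Here \<open>s\<close> is the slope of the surface, \<open>c = - \<gamma> 0\<close>, \<open>t = \<gamma>' 0\<close>, \<open>a = u\<^sub>x\<close> and \<open>k = u\<^sub>x\<^sub>y\<close>; at a critical point of
  \<open>u\<^sub>x\<close> along the surface \<open>u\<^sub>y\<^sub>y = s k - t u\<close>, and \<open>dbern\<close> is the derivative of \<open>bern\<close>.\<close>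

lemma slope_form_identity:
  fixes u v :: real
  assumes u: "u \<noteq> 0" and s: "v = s * u" and vx: "vx = uy - c" and b: "b = 2 * uy - c"
    and bern: "(u^2 - v^2) * a + u * v * b + g * v = 0"
    and dbern: "2 * (u * (a + s * uy) - v * (vx - s * a)) * a + ((a + s * uy) * v + u * (vx - s * a)) * b
        + u * v * (2 * (k + s * (s * k - t * u))) + g * (vx - s * a) = 0"
  shows "slope_form (-u) v a b c + 4 * v^2 * (u^2 + v^2) * k - 4 * t * u^2 * v^3 = 0"
proof -
  have gs: "g * s = - ((u - s^2 * u) * a + s * u * b)"
  proof -
    have "u * (g * s) = u * (- ((u - s^2 * u) * a + s * u * b))" using bern unfolding s by algebra
    then show ?thesis using u by simp
  qed
  \<comment> \<open>The right-hand side is 2 u v times \<open>dbern\<close>: since v = s u, the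
    factor g occurs only as g s, which \<open>gs\<close> expresses through a and b.\<close>
  have "slope_form (-u) v a b c + 4 * v^2 * (u^2 + v^2) * k - 4 * t * u^2 * v^3
      = 2 * v * u * (2 * (u * (a + s * uy) - v * (vx - s * a)) * a + ((a + s * uy) * v + u * (vx - s * a)) * b
        + u * v * (2 * (k + s * (s * k - t * u)))) + 2 * u^2 * (g * s) * (vx - s * a)"
    unfolding gs slope_form_def vx b s by algebra
  also have "\<dots> = 0" using dbern unfolding s by algebra
  finally show ?thesis .
qed

section \<open>Favorable monotone waves\<close>

text \<open>\<open>U i j\<close> is the continuous extension of \<open>\<partial>\<^sub>x\<^sup>i \<partial>\<^sub>y\<^sup>j u\<close> to the closed fluid domain, and
  likewise for \<open>V\<close> and \<open>P\<close>.\<close>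

locale favorable_wave =
  fixes g L d Patm m :: real and \<eta> \<eta>' :: "real \<Rightarrow> real"
    and U V P :: "nat \<Rightarrow> nat \<Rightarrow> real \<times> real \<Rightarrow> real"
    and \<psi> :: "real \<times> real \<Rightarrow> real" and \<gamma> \<gamma>' \<gamma>'' :: "real \<Rightarrow> real"
  assumes g_pos: "g > 0" and L_pos: "L > 0" and m_pos: "m > 0"
    and \<eta>_gt: "- d < \<eta> x"
    and \<eta>_deriv: "(\<eta> has_real_derivative \<eta>' x) (at x)" and \<eta>'_cont: "continuous_on UNIV \<eta>'"
    and U_cont: "i + j \<le> 3 \<Longrightarrow> continuous_on (closure (strip d \<eta>)) (U i j)"
    and U_partials: "i + j < 3 \<Longrightarrow> partials (strip d \<eta>) (U i j) (U (Suc i) j) (U i (Suc j))"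
    and V_cont: "i + j \<le> 3 \<Longrightarrow> continuous_on (closure (strip d \<eta>)) (V i j)"
    and V_partials: "i + j < 3 \<Longrightarrow> partials (strip d \<eta>) (V i j) (V (Suc i) j) (V i (Suc j))"
    and P_cont: "i + j \<le> 3 \<Longrightarrow> continuous_on (closure (strip d \<eta>)) (P i j)"
    and P_partials: "i + j < 3 \<Longrightarrow> partials (strip d \<eta>) (P i j) (P (Suc i) j) (P i (Suc j))"
    and periodic: "(x,y) \<in> closure (strip d \<eta>) \<Longrightarrow> U 0 0 (x + 2 * L, y) = U 0 0 (x,y)"
      "(x,y) \<in> closure (strip d \<eta>) \<Longrightarrow> V 0 0 (x + 2 * L, y) = V 0 0 (x,y)"
    and \<eta>_periodic: "\<eta> (x + 2 * L) = \<eta> x"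
    and symmetric: "(x,y) \<in> closure (strip d \<eta>) \<Longrightarrow> U 0 0 (- x, y) = U 0 0 (x,y)"
      "(x,y) \<in> closure (strip d \<eta>) \<Longrightarrow> V 0 0 (- x, y) = - V 0 0 (x,y)"
    and \<eta>_even: "\<eta> (- x) = \<eta> x"
    and euler: "p \<in> strip d \<eta> \<Longrightarrow> U 0 0 p * U 1 0 p + V 0 0 p * U 0 1 p = - P 1 0 p"
      "p \<in> strip d \<eta> \<Longrightarrow> U 0 0 p * V 1 0 p + V 0 0 p * V 0 1 p = - P 0 1 p - g"
      "p \<in> strip d \<eta> \<Longrightarrow> U 1 0 p + V 0 1 p = 0"
    and surface: "P 0 0 (x, \<eta> x) = Patm" "V 0 0 (x, \<eta> x) = \<eta>' x * U 0 0 (x, \<eta> x)"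
    and bottom: "V 0 0 (x, - d) = 0"
    and U_neg_strip: "\<exists>c<0. \<forall>p\<in>strip d \<eta>. U 0 0 p \<le> c"
    and \<psi>_cont: "continuous_on (closure (strip d \<eta>)) \<psi>"
    and \<psi>_partials: "partials (strip d \<eta>) \<psi> (\<lambda>p. - V 0 0 p) (U 0 0)"
    and \<psi>_surface: "\<psi> (x, \<eta> x) = 0" and \<psi>_bottom: "\<psi> (x, - d) = m"
    and \<gamma>_deriv: "s \<in> {0..m} \<Longrightarrow> (\<gamma> has_real_derivative \<gamma>' s) (at s within {0..m})"
      "s \<in> {0..m} \<Longrightarrow> (\<gamma>' has_real_derivative \<gamma>'' s) (at s within {0..m})"
    and \<gamma>_sign: "0 < s \<Longrightarrow> s < m \<Longrightarrow> \<gamma> s \<le> 0" "0 < s \<Longrightarrow> s < m \<Longrightarrow> \<gamma>' s \<le> 0" "0 < s \<Longrightarrow> s < m \<Longrightarrow> \<gamma>'' s \<le> 0"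
    and vorticity: "p \<in> strip d \<eta> \<Longrightarrow> V 1 0 p - U 0 1 p = \<gamma> (\<psi> p)"
    and monotone: "0 < x \<Longrightarrow> x < L \<Longrightarrow> - d < y \<Longrightarrow> y \<le> \<eta> x \<Longrightarrow> V 0 0 (x,y) > 0"
    and trough: "g - \<gamma> 0 * U 0 0 (L, \<eta> L) > 0"
begin

section \<open>Geometry of the domain and passage to its closure\<close>

abbreviation "\<Omega> \<equiv> strip d \<eta>"

lemma \<eta>_cont: "continuous_on UNIV \<eta>"
  using \<eta>_deriv by (meson DERIV_isCont continuous_at_imp_continuous_on)

lemma open_\<Omega>: "open \<Omega>" by (rule open_strip[OF \<eta>_cont])

lemma closure_\<Omega>: "closure \<Omega> = {(x,y). - d \<le> y \<and> y \<le> \<eta> x}"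
  by (rule closure_strip[OF \<eta>_cont \<eta>_gt])

lemma surface_in_closure: "(x, \<eta> x) \<in> closure \<Omega>"
  using \<eta>_gt[of x] by (simp add: closure_\<Omega>)

lemma closure_\<Omega>_symmetric: "(x,y) \<in> closure \<Omega> \<Longrightarrow> (- x, y) \<in> closure \<Omega>"
  by (simp add: closure_\<Omega> \<eta>_even)

lemma eq_on_closure:
  fixes f h :: "real \<times> real \<Rightarrow> real"
  assumes "continuous_on (closure \<Omega>) f" "continuous_on (closure \<Omega>) h"
    "\<And>p. p \<in> \<Omega> \<Longrightarrow> f p = h p" "p \<in> closure \<Omega>"
  shows "f p = h p"
  using continuous_constant_on_closure[of \<Omega> "\<lambda>p. f p - h p" 0 p] assms
  by (simp add: continuous_on_diff)

text \<open>The bound away from zero in \<open>U_neg_strip\<close> is what keeps the inequality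
  strict on the boundary.\<close>

lemma U_neg: "p \<in> closure \<Omega> \<Longrightarrow> U 0 0 p < 0"
  using U_neg_strip continuous_le_on_closure[OF U_cont[of 0 0]] by fastforce

lemma U_surface_deriv:
  "i + j < 3 \<Longrightarrow> ((\<lambda>x. U i j (x, \<eta> x)) has_real_derivative U (Suc i) j (x, \<eta> x) + \<eta>' x * U i (Suc j) (x, \<eta> x)) (at x)"
  by (rule surface_has_derivative[OF \<eta>_gt \<eta>_deriv \<eta>'_cont U_partials]) (auto intro: U_cont)

lemma V_surface_deriv:
  "i + j < 3 \<Longrightarrow> ((\<lambda>x. V i j (x, \<eta> x)) has_real_derivative V (Suc i) j (x, \<eta> x) + \<eta>' x * V i (Suc j) (x, \<eta> x)) (at x)"
  by (rule surface_has_derivative[OF \<eta>_gt \<eta>_deriv \<eta>'_cont V_partials]) (auto intro: V_cont)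

lemma P_surface_deriv:
  "((\<lambda>x. P 0 0 (x, \<eta> x)) has_real_derivative P 1 0 (x, \<eta> x) + \<eta>' x * P 0 1 (x, \<eta> x)) (at x)"
  using surface_has_derivative[OF \<eta>_gt \<eta>_deriv \<eta>'_cont P_partials[of 0 0] P_cont P_cont P_cont] by simp

text \<open>\<psi> is strictly decreasing in y because \<psi>_y = u < 0. Interior points thus land
  in the open interval where the signs of \<gamma>, \<gamma>' and \<gamma>'' are given and their
  derivatives are two-sided.\<close>

lemma \<psi>_range:
  assumes "p \<in> \<Omega>" shows "0 < \<psi> p" "\<psi> p < m"
proof -
  obtain x y where p: "p = (x,y)" "- d < y" "y < \<eta> x" using assms by (auto simp: strip_def)
  have cont: "continuous_on {- d..\<eta> x} (\<lambda>t. \<psi> (x,t))"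
    by (rule continuous_on_compose2[OF \<psi>_cont]) (auto simp: closure_\<Omega> intro!: continuous_intros)
  have der: "((\<lambda>t. \<psi> (x,t)) has_real_derivative U 0 0 (x,t)) (at t)" if "- d < t" "t < \<eta> x" for t
    by (rule partialsD(2)[OF \<psi>_partials]) (simp add: mem_strip that)
  have neg: "U 0 0 (x,t) < 0" if "- d < t" "t < \<eta> x" for t
    using that by (intro U_neg) (simp add: closure_\<Omega>)
  have dec: "\<psi> (x,t) < \<psi> (x,s)" if "- d \<le> s" "s < t" "t \<le> \<eta> x" for s t
    using DERIV_neg_imp_decreasing_open[OF that(2), of "\<lambda>t. \<psi> (x,t)"] der neg that
      continuous_on_subset[OF cont, of "{s..t}"] by force
  show "0 < \<psi> p" using dec[of y "\<eta> x"] p \<psi>_surface by simp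
  show "\<psi> p < m" using dec[of "- d" y] p \<psi>_bottom by simp
qed

lemma \<psi>_range_closure: "p \<in> closure \<Omega> \<Longrightarrow> \<psi> p \<in> {0..m}"
  using continuous_ge_on_closure[OF \<psi>_cont, of p 0] continuous_le_on_closure[OF \<psi>_cont, of p m] \<psi>_range
  by (force simp: less_imp_le)

lemma \<gamma>_cont: "continuous_on {0..m} \<gamma>" "continuous_on {0..m} \<gamma>'"
  unfolding continuous_on_eq_continuous_within using \<gamma>_deriv DERIV_continuous by blast+

lemma \<gamma>_nonpos: "s \<in> {0..m} \<Longrightarrow> \<gamma> s \<le> 0" "s \<in> {0..m} \<Longrightarrow> \<gamma>' s \<le> 0"
  using continuous_le_on_closure[of "{0<..<m}" \<gamma> s 0] continuous_le_on_closure[of "{0<..<m}" \<gamma>' s 0]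
    \<gamma>_cont \<gamma>_sign m_pos by auto

lemma \<gamma>_\<psi>_cont: "continuous_on (closure \<Omega>) (\<lambda>p. \<gamma> (\<psi> p))" "continuous_on (closure \<Omega>) (\<lambda>p. \<gamma>' (\<psi> p))"
  by (rule continuous_on_compose2[OF _ \<psi>_cont], rule \<gamma>_cont, use \<psi>_range_closure in blast)+

lemma \<gamma>_deriv_interior:
  assumes "p \<in> \<Omega>"
  shows "(\<gamma> has_real_derivative \<gamma>' (\<psi> p)) (at (\<psi> p))" "(\<gamma>' has_real_derivative \<gamma>'' (\<psi> p)) (at (\<psi> p))"
proof -
  have "at (\<psi> p) within {0..m} = at (\<psi> p)"
    using \<psi>_range[OF assms] by (intro at_within_interior) (simp add: interior_atLeastAtMost_real)
  then show "(\<gamma> has_real_derivative \<gamma>' (\<psi> p)) (at (\<psi> p))" "(\<gamma>' has_real_derivative \<gamma>'' (\<psi> p)) (at (\<psi> p))"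
    using \<gamma>_deriv[of "\<psi> p"] \<psi>_range[OF assms] by auto
qed

section \<open>Field equations inside and up to the surface\<close>

lemma incompressible: "p \<in> closure \<Omega> \<Longrightarrow> V 0 1 p = - U 1 0 p"
proof (rule eq_on_closure[of "V 0 1" "\<lambda>p. - U 1 0 p"])
  show "V 0 1 p = - U 1 0 p" if "p \<in> \<Omega>" for p using euler(3)[OF that] by simp
qed (auto intro!: U_cont V_cont continuous_on_minus)

lemma vorticity_closure: "p \<in> closure \<Omega> \<Longrightarrow> V 1 0 p = U 0 1 p + \<gamma> (\<psi> p)"
proof (rule eq_on_closure[of "V 1 0" "\<lambda>p. U 0 1 p + \<gamma> (\<psi> p)"])
  show "V 1 0 p = U 0 1 p + \<gamma> (\<psi> p)" if "p \<in> \<Omega>" for p using vorticity[OF that] by simp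
qed (use V_cont[of 1 0] U_cont[of 0 1] \<gamma>_\<psi>_cont in \<open>auto intro: continuous_on_add\<close>)

lemma vorticity_surface: "V 1 0 (x, \<eta> x) = U 0 1 (x, \<eta> x) + \<gamma> 0"
  using vorticity_closure[OF surface_in_closure] by (simp add: \<psi>_surface)

text \<open>v_xy is computed twice, as -u_xx from incompressibility and as u_yy + \<gamma>'(\<psi>)
  u from the vorticity equation. Comparing the two gives the Laplacian of u.\<close>

lemma second_order_relations:
  assumes p: "p \<in> \<Omega>"
  shows "V 2 0 p = U 1 1 p - \<gamma>' (\<psi> p) * V 0 0 p" "V 0 2 p = - U 1 1 p"
    "U 2 0 p + U 0 2 p = - \<gamma>' (\<psi> p) * U 0 0 p"
proof -
  have "partials \<Omega> (V 0 1) (V 1 1) (V 0 2)" using V_partials[of 0 1] by (simp add: numeral_2_eq_2)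
  note v1 = this
  have "partials \<Omega> (V 0 1) (\<lambda>p. - 1 * U 2 0 p) (\<lambda>p. - 1 * U 1 1 p)"
    by (rule partials_cong[OF open_\<Omega> partials_cmult[OF U_partials[of 1 0], of "- 1"]])
      (use incompressible closure_subset[of \<Omega>] in \<open>auto simp: numeral_2_eq_2\<close>)
  from partials_unique[OF v1 this p] have v: "V 1 1 p = - U 2 0 p" "V 0 2 p = - U 1 1 p" by simp_all
  show "V 0 2 p = - U 1 1 p" by (rule v)
  have "partials \<Omega> (V 1 0) (V 2 0) (V 1 1)" using V_partials[of 1 0] by (simp add: numeral_2_eq_2)
  note v2 = this
  have "partials \<Omega> (V 1 0) (\<lambda>p. U 1 1 p + \<gamma>' (\<psi> p) * - V 0 0 p) (\<lambda>p. U 0 2 p + \<gamma>' (\<psi> p) * U 0 0 p)"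
    by (rule partials_cong[OF open_\<Omega> partials_add[OF U_partials[of 0 1] partials_compose[OF \<psi>_partials \<gamma>_deriv_interior(1)]]])
      (use vorticity_closure closure_subset[of \<Omega>] in \<open>auto simp: numeral_2_eq_2\<close>)
  from partials_unique[OF v2 this p] show "V 2 0 p = U 1 1 p - \<gamma>' (\<psi> p) * V 0 0 p" "U 2 0 p + U 0 2 p = - \<gamma>' (\<psi> p) * U 0 0 p"
    using v by auto
qed

lemma laplacian_U_closure:
  "p \<in> closure \<Omega> \<Longrightarrow> U 0 2 p = - U 2 0 p - \<gamma>' (\<psi> p) * U 0 0 p"
proof (rule eq_on_closure[of "U 0 2" "\<lambda>p. - U 2 0 p - \<gamma>' (\<psi> p) * U 0 0 p"])
  show "continuous_on (closure \<Omega>) (\<lambda>p. - U 2 0 p - \<gamma>' (\<psi> p) * U 0 0 p)"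
    by (intro continuous_on_diff continuous_on_minus continuous_on_mult \<gamma>_\<psi>_cont U_cont) auto
  show "U 0 2 p = - U 2 0 p - \<gamma>' (\<psi> p) * U 0 0 p" if "p \<in> \<Omega>" for p
    using second_order_relations(3)[OF that] by simp
qed (auto intro: U_cont)

text \<open>Obtained by differentiating the formula for u_yy in x, with \<psi>_x = -v producing the
  \<gamma>'' term.\<close>

lemma laplacian_Ux:
  assumes p: "p \<in> \<Omega>"
  shows "U 3 0 p + U 1 2 p = \<gamma>'' (\<psi> p) * V 0 0 p * U 0 0 p - \<gamma>' (\<psi> p) * U 1 0 p"
proof -
  have "partials \<Omega> (U 0 2) (U 1 2) (U 0 3)" using U_partials[of 0 2] by (simp add: numeral_2_eq_2 numeral_3_eq_3)
  note u1 = this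
  have "- 1 * U 2 0 p - \<gamma>' (\<psi> p) * U 0 0 p = U 0 2 p" if "p \<in> \<Omega>" for p
    using second_order_relations(3)[OF that] by simp
  note eq = this
  have "partials \<Omega> (U 0 2) (\<lambda>p. - 1 * U 3 0 p - (\<gamma>'' (\<psi> p) * - V 0 0 p * U 0 0 p + \<gamma>' (\<psi> p) * U 1 0 p))
      (\<lambda>p. - 1 * U 2 1 p - (\<gamma>'' (\<psi> p) * U 0 0 p * U 0 0 p + \<gamma>' (\<psi> p) * U 0 1 p))"
    by (rule partials_cong[OF open_\<Omega> partials_diff[OF partials_cmult[OF U_partials[of 2 0], of "- 1"]
        partials_mult[OF partials_compose[OF \<psi>_partials \<gamma>_deriv_interior(2)] U_partials[of 0 0]]]])
      (use eq in \<open>auto simp: numeral_2_eq_2 numeral_3_eq_3\<close>)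
  from partials_unique(1)[OF u1 this p] show ?thesis by simp
qed

text \<open>Pressure is constant along the surface and the velocity is tangent to it, so u P_x + v
  P_y = 0 there. Substituting the Euler equations removes the pressure.\<close>

lemma bernoulli_slope:
  fixes x defines "p \<equiv> (x, \<eta> x)"
  shows "((U 0 0 p)^2 - (V 0 0 p)^2) * U 1 0 p + U 0 0 p * V 0 0 p * (2 * U 0 1 p + \<gamma> 0) + g * V 0 0 p = 0"
proof -
  have p: "p \<in> closure \<Omega>" by (simp add: p_def surface_in_closure)
  have e1: "U 0 0 p * U 1 0 p + V 0 0 p * U 0 1 p = - P 1 0 p"
    by (rule eq_on_closure[OF _ _ euler(1) p])
      (auto intro!: continuous_on_add continuous_on_mult continuous_on_minus U_cont V_cont P_cont)
  have e2: "U 0 0 p * V 1 0 p + V 0 0 p * V 0 1 p = - P 0 1 p - g"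
    by (rule eq_on_closure[OF _ _ euler(2) p])
      (auto intro!: continuous_on_add continuous_on_mult continuous_on_diff continuous_on_minus U_cont V_cont P_cont)
  have "P 1 0 p + \<eta>' x * P 0 1 p = 0"
    using P_surface_deriv[of x] surface(1) DERIV_unique[OF _ DERIV_const] by (simp add: p_def)
  then have "U 0 0 p * P 1 0 p + (\<eta>' x * U 0 0 p) * P 0 1 p = 0" by algebra
  then have "U 0 0 p * P 1 0 p + V 0 0 p * P 0 1 p = 0" using surface(2)[of x] by (simp add: p_def)
  moreover have "V 0 1 p = - U 1 0 p" "V 1 0 p = U 0 1 p + \<gamma> 0"
    using incompressible[OF p] vorticity_surface by (auto simp: p_def)
  ultimately show ?thesis using e1 e2 by algebra
qed

section \<open>The half-period cell and boundary values\<close>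

lemma V_sides:
  assumes "- d \<le> y"
  shows "y \<le> \<eta> 0 \<Longrightarrow> V 0 0 (0,y) = 0" "y \<le> \<eta> L \<Longrightarrow> V 0 0 (L,y) = 0"
proof -
  assume "y \<le> \<eta> 0"
  then show "V 0 0 (0,y) = 0" using symmetric(2)[of 0 y] assms by (simp add: closure_\<Omega>)
next
  assume "y \<le> \<eta> L"
  then have "(L,y) \<in> closure \<Omega>" "(- L,y) \<in> closure \<Omega>" using assms by (auto simp: closure_\<Omega> \<eta>_even)
  then show "V 0 0 (L,y) = 0" using symmetric(2)[of L y] periodic(2)[of "- L" y] by simp
qed

lemma V_nonneg:
  assumes "0 \<le> x" "x \<le> L" "- d \<le> y" "y \<le> \<eta> x"
  shows "V 0 0 (x,y) \<ge> 0"
  using assms V_sides[of y] bottom[of x] monotone[of x y]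
  by (cases "x = 0 \<or> x = L \<or> y = - d") (auto simp: order_le_less)

lemma Ux_sides:
  assumes a: "a = 0 \<or> a = L" and y: "- d \<le> y" "y \<le> \<eta> a"
  shows "U 1 0 (a,y) = 0"
proof -
  have refl: "\<eta> (a - h) = \<eta> (a + h)" for h
    using a \<eta>_even[of h] \<eta>_even[of "L - h"] \<eta>_periodic[of "h - L"] by (auto simp: algebra_simps)
  have interior: "U 1 0 (a,t) = 0" if t: "- d < t" "t < \<eta> a" for t
  proof (rule even_deriv_zero)
    have "(a,t) \<in> \<Omega>" using t by (simp add: mem_strip)
    \<comment> \<open>Symmetry is known only on the closed domain. Replacing values outside by the
      value at (a,t) gives a function even about a for all h, unchanged near a.\<close>
    then show "((\<lambda>s. U 0 0 (if (s,t) \<in> closure \<Omega> then (s,t) else (a,t))) has_real_derivative U 1 0 (a,t)) (at a)"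
    proof -
      assume at: "(a,t) \<in> \<Omega>"
      obtain r where r: "r > 0" "\<And>x y. \<bar>x - a\<bar> < r \<Longrightarrow> \<bar>y - t\<bar> < r \<Longrightarrow> (x,y) \<in> \<Omega>"
        using open_box[OF open_\<Omega> at] by blast
      have "\<forall>\<^sub>F s in nhds a. U 0 0 (if (s,t) \<in> closure \<Omega> then (s,t) else (a,t)) = U 0 0 (s,t)"
        unfolding eventually_nhds_metric dist_real_def using r(1) r(2)[of _ t] closure_subset[of \<Omega>]
        by (intro exI[of _ r]) auto
      from DERIV_cong_ev[OF HOL.refl this HOL.refl, of "U 1 0 (a,t)"] partialsD(1)[OF U_partials[of 0 0] at]
      show ?thesis by simp
    qed
    fix h
    have iff: "(a - h, t) \<in> closure \<Omega> \<longleftrightarrow> (a + h, t) \<in> closure \<Omega>" by (simp add: closure_\<Omega> refl)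
    moreover have "U 0 0 (a - h, t) = U 0 0 (a + h, t)" if "(a - h, t) \<in> closure \<Omega>"
      using a
    proof
      assume "a = 0"
      then show ?thesis using symmetric(1)[of h t] that iff by simp
    next
      assume aL: "a = L"
      have "(h - L, t) \<in> closure \<Omega>" using closure_\<Omega>_symmetric[OF that] aL by simp
      then show ?thesis using symmetric(1)[of "h - L" t] periodic(1)[of "h - L" t] aL by (simp add: algebra_simps)
    qed
    ultimately show "U 0 0 (if (a - h,t) \<in> closure \<Omega> then (a - h,t) else (a,t))
        = U 0 0 (if (a + h,t) \<in> closure \<Omega> then (a + h,t) else (a,t))" by auto
  qed
  have "continuous_on {- d..\<eta> a} (\<lambda>t. U 1 0 (a,t))"
    by (rule continuous_on_compose2[OF U_cont[of 1 0]]) (auto simp: closure_\<Omega> intro!: continuous_intros)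
  then show ?thesis
    using continuous_constant_on_closure[of "{- d<..<\<eta> a}" "\<lambda>t. U 1 0 (a,t)" 0 y] interior y \<eta>_gt[of a] by simp
qed

definition cell :: "(real \<times> real) set" where
  "cell = {(x,y). 0 \<le> x \<and> x \<le> L \<and> - d \<le> y \<and> y \<le> \<eta> x}"

definition cell_interior :: "(real \<times> real) set" where
  "cell_interior = {(x,y). 0 < x \<and> x < L \<and> - d < y \<and> y < \<eta> x}"

lemma cell_subset_closure: "cell \<subseteq> closure \<Omega>"
  by (auto simp: cell_def closure_\<Omega>)

lemma cell_interior_subset: "cell_interior \<subseteq> \<Omega>" "cell_interior \<subseteq> cell"
  by (auto simp: cell_def cell_interior_def mem_strip)

lemma surface_in_cell: "0 \<le> x \<Longrightarrow> x \<le> L \<Longrightarrow> (x, \<eta> x) \<in> cell"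
  using \<eta>_gt[of x] by (simp add: cell_def)

lemma open_cell_interior: "open cell_interior"
proof -
  have "cell_interior = \<Omega> \<inter> {p. 0 < fst p} \<inter> {p. fst p < L}"
    by (auto simp: cell_interior_def mem_strip)
  then show ?thesis
    using open_\<Omega> by (auto intro!: open_Int open_Collect_less continuous_intros)
qed

text \<open>The cell is the continuous image of a rectangle, obtained by stretching each vertical
  fiber affinely.\<close>

lemma compact_cell: "compact cell"
proof -
  let ?f = "\<lambda>p. (fst p, - d + snd p * (\<eta> (fst p) + d))"
  have "cell = ?f ` ({0..L} \<times> {0..1})"
  proof (intro set_eqI iffI; clarify)
    fix x y assume xy: "(x,y) \<in> cell"
    define t where "t = (y + d) / (\<eta> x + d)"
    have "?f (x,t) = (x,y)" using \<eta>_gt[of x] by (simp add: t_def)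
    moreover have "(x,t) \<in> {0..L} \<times> {0..1}" using xy \<eta>_gt[of x] by (auto simp: t_def cell_def field_simps)
    ultimately show "(x,y) \<in> ?f ` ({0..L} \<times> {0..1})" by (intro image_eqI[of _ ?f "(x,t)"]) simp_all
  next
    fix x t :: real assume xt: "x \<in> {0..L}" "t \<in> {0..1}"
    have "0 \<le> t * (\<eta> x + d)" using xt \<eta>_gt[of x] by simp
    moreover have "t * (\<eta> x + d) \<le> 1 * (\<eta> x + d)" using xt \<eta>_gt[of x] by (intro mult_right_mono) auto
    ultimately show "(fst (x,t), - d + snd (x,t) * (\<eta> (fst (x,t)) + d)) \<in> cell" using xt by (auto simp: cell_def)
  qed
  moreover have "continuous_on ({0..L} \<times> {0..1}) ?f"
    by (intro continuous_intros continuous_on_compose2[OF \<eta>_cont]) auto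
  ultimately show ?thesis
    using compact_continuous_image[of "{0..L} \<times> {0..1}" ?f] compact_Times[OF compact_Icc compact_Icc] by simp
qed

lemma U_neg_cell: "p \<in> cell \<Longrightarrow> U 0 0 p < 0" and V_nonneg_cell: "p \<in> cell \<Longrightarrow> V 0 0 p \<ge> 0"
  using U_neg cell_subset_closure V_nonneg by (auto simp: cell_def)

section \<open>Speed along the surface and the trough condition\<close>

lemma surface_decreasing:
  assumes "0 \<le> x" "x \<le> L" shows "\<eta> L \<le> \<eta> x"
proof (rule DERIV_nonpos_imp_nonincreasing[OF assms(2)])
  fix t assume t: "x \<le> t" "t \<le> L"
  then have "(t, \<eta> t) \<in> cell" using surface_in_cell assms by simp
  then have "\<eta>' t * U 0 0 (t, \<eta> t) \<ge> 0" "U 0 0 (t, \<eta> t) < 0"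
    using V_nonneg_cell U_neg_cell surface(2)[of t] by metis+
  then have "\<eta>' t \<le> 0" by (simp add: zero_le_mult_iff)
  then show "\<exists>y. (\<eta> has_real_derivative y) (at t) \<and> y \<le> 0" using \<eta>_deriv by blast
qed

text \<open>u^2 + v^2 + 2 g \<eta> is constant on the surface, \<eta> is least at the trough, and v
  vanishes there.\<close>

lemma surface_speed_le_trough:
  assumes "0 \<le> x" "x \<le> L"
  shows "(U 0 0 (x, \<eta> x))^2 + (V 0 0 (x, \<eta> x))^2 \<le> (U 0 0 (L, \<eta> L))^2"
proof -
  let ?E = "\<lambda>x. (U 0 0 (x, \<eta> x))^2 + (V 0 0 (x, \<eta> x))^2 + 2 * g * \<eta> x"
  have "(?E has_real_derivative 0) (at t)" for t
  proof -
    let ?p = "(t, \<eta> t)"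
    have u: "U 0 0 ?p < 0" by (rule U_neg[OF surface_in_closure])
    have "((\<lambda>x. U 0 0 (x, \<eta> x)) has_real_derivative U 1 0 ?p + \<eta>' t * U 0 1 ?p) (at t)"
      "((\<lambda>x. V 0 0 (x, \<eta> x)) has_real_derivative V 1 0 ?p + \<eta>' t * V 0 1 ?p) (at t)"
      using U_surface_deriv[of 0 0 t] V_surface_deriv[of 0 0 t] by auto
    from DERIV_add[OF DERIV_add[OF DERIV_power[OF this(1), of 2] DERIV_power[OF this(2), of 2]] DERIV_cmult[OF \<eta>_deriv, of "2 * g" t]]
    have der: "(?E has_real_derivative 2 * (U 0 0 ?p * (U 1 0 ?p + \<eta>' t * U 0 1 ?p)
        + V 0 0 ?p * (V 1 0 ?p + \<eta>' t * V 0 1 ?p) + g * \<eta>' t)) (at t)" (is "(_ has_real_derivative 2 * ?D) _")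
      by (rule DERIV_cong) (simp add: algebra_simps)
    have v: "V 0 0 ?p = \<eta>' t * U 0 0 ?p" and vx: "V 1 0 ?p = U 0 1 ?p + \<gamma> 0" and vy: "V 0 1 ?p = - U 1 0 ?p"
      using surface(2) vorticity_surface incompressible[OF surface_in_closure] by auto
    \<comment> \<open>After insertion of the surface relations, u times half the tangential
      derivative is the left side of \<open>bernoulli_slope\<close>.\<close>
    have "U 0 0 ?p * ?D = 0" using bernoulli_slope[of t] unfolding v vx vy by algebra
    then have "?D = 0" using u by simp
    then show ?thesis using der by simp
  qed
  then have "?E x = ?E L" by (intro DERIV_isconst_all) auto
  moreover have "V 0 0 (L, \<eta> L) = 0" using V_sides(2)[of "\<eta> L"] \<eta>_gt[of L] by simp
  moreover have "g * \<eta> L \<le> g * \<eta> x" using surface_decreasing[OF assms] g_pos by simp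
  ultimately show ?thesis by simp
qed

lemma gravity_dominates:
  assumes "0 \<le> x" "x \<le> L"
  shows "- \<gamma> 0 * - U 0 0 (x, \<eta> x) \<le> g" "- \<gamma> 0 * V 0 0 (x, \<eta> x) \<le> g"
proof -
  let ?w = "- U 0 0 (L, \<eta> L)"
  have w: "?w > 0" using U_neg[OF surface_in_closure, of L] by simp
  have c: "- \<gamma> 0 \<ge> 0" using \<gamma>_nonpos(1)[of 0] m_pos by simp
  have cw: "- \<gamma> 0 * ?w \<le> g" using trough by simp
  have q: "(U 0 0 (x, \<eta> x))^2 \<le> ?w^2" "(V 0 0 (x, \<eta> x))^2 \<le> ?w^2"
    using surface_speed_le_trough[OF assms] zero_le_power2[of "U 0 0 (x, \<eta> x)"] zero_le_power2[of "V 0 0 (x, \<eta> x)"]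
    unfolding power2_minus by linarith+
  have "- U 0 0 (x, \<eta> x) \<le> ?w" "V 0 0 (x, \<eta> x) \<le> ?w"
    using abs_le_square_iff[of "U 0 0 (x, \<eta> x)" ?w] abs_le_square_iff[of "V 0 0 (x, \<eta> x)" ?w] q w by auto
  then have "- \<gamma> 0 * - U 0 0 (x, \<eta> x) \<le> - \<gamma> 0 * ?w" "- \<gamma> 0 * V 0 0 (x, \<eta> x) \<le> - \<gamma> 0 * ?w"
    using c by (intro mult_left_mono; simp)+
  then show "- \<gamma> 0 * - U 0 0 (x, \<eta> x) \<le> g" "- \<gamma> 0 * V 0 0 (x, \<eta> x) \<le> g" using cw by linarith+
qed

section \<open>Sign of u_x on the cell\<close>

lemma no_critical_surface_point:
  assumes x: "0 < x" "x < L" and a: "U 1 0 (x, \<eta> x) \<ge> 0"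
    and tangential: "U 2 0 (x, \<eta> x) + \<eta>' x * U 1 1 (x, \<eta> x) = 0" and k: "U 1 1 (x, \<eta> x) \<ge> 0"
  shows False
proof -
  let ?p = "(x, \<eta> x)"
  have p: "?p \<in> closure \<Omega>" by (rule surface_in_closure)
  have u: "U 0 0 ?p < 0" by (rule U_neg[OF p])
  have v: "V 0 0 ?p > 0" using monotone[of x "\<eta> x"] x \<eta>_gt[of x] by simp
  have s: "V 0 0 ?p = \<eta>' x * U 0 0 ?p" by (rule surface(2))
  have vx: "V 1 0 ?p = U 0 1 ?p - (- \<gamma> 0)" using vorticity_surface by simp
  have vy: "V 0 1 ?p = - U 1 0 ?p" by (rule incompressible[OF p])
  define b where "b = 2 * U 0 1 ?p - (- \<gamma> 0)"
  have bern: "((U 0 0 ?p)^2 - (V 0 0 ?p)^2) * U 1 0 ?p + U 0 0 ?p * V 0 0 ?p * b + g * V 0 0 ?p = 0"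
    using bernoulli_slope[of x] by (simp add: b_def)
  \<comment> \<open>Criticality gives u_xx = -\<eta>' u_xy, so u_xy is the only second derivative of
    u left.\<close>
  have uyy: "U 0 2 ?p = \<eta>' x * U 1 1 ?p - \<gamma>' 0 * U 0 0 ?p"
    using laplacian_U_closure[OF p] tangential \<psi>_surface[of x] by simp
  have dbern: "2 * (U 0 0 ?p * (U 1 0 ?p + \<eta>' x * U 0 1 ?p) - V 0 0 ?p * (V 1 0 ?p - \<eta>' x * U 1 0 ?p)) * U 1 0 ?p
      + ((U 1 0 ?p + \<eta>' x * U 0 1 ?p) * V 0 0 ?p + U 0 0 ?p * (V 1 0 ?p - \<eta>' x * U 1 0 ?p)) * b
      + U 0 0 ?p * V 0 0 ?p * (2 * (U 1 1 ?p + \<eta>' x * (\<eta>' x * U 1 1 ?p - \<gamma>' 0 * U 0 0 ?p)))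
      + g * (V 1 0 ?p - \<eta>' x * U 1 0 ?p) = 0" (is "?D = 0")
  proof -
    have dU: "((\<lambda>x. U 0 0 (x, \<eta> x)) has_real_derivative U 1 0 ?p + \<eta>' x * U 0 1 ?p) (at x)"
      using U_surface_deriv[of 0 0 x] by simp
    have dV: "((\<lambda>x. V 0 0 (x, \<eta> x)) has_real_derivative V 1 0 ?p - \<eta>' x * U 1 0 ?p) (at x)"
      using V_surface_deriv[of 0 0 x] vy by simp
    have dUx: "((\<lambda>x. U 1 0 (x, \<eta> x)) has_real_derivative 0) (at x)"
      using U_surface_deriv[of 1 0 x] tangential by (simp add: numeral_2_eq_2)
    have dUy: "((\<lambda>x. U 0 1 (x, \<eta> x)) has_real_derivative U 1 1 ?p + \<eta>' x * (\<eta>' x * U 1 1 ?p - \<gamma>' 0 * U 0 0 ?p)) (at x)"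
      using U_surface_deriv[of 0 1 x] uyy by (simp add: numeral_2_eq_2)
    have "((\<lambda>x. ((U 0 0 (x, \<eta> x))^2 - (V 0 0 (x, \<eta> x))^2) * U 1 0 (x, \<eta> x)
        + U 0 0 (x, \<eta> x) * V 0 0 (x, \<eta> x) * (2 * U 0 1 (x, \<eta> x) + \<gamma> 0) + g * V 0 0 (x, \<eta> x)) has_real_derivative ?D) (at x)"
      by (rule derivative_eq_intros dU dV dUx dUy refl)+ (simp add: b_def algebra_simps)
    then show ?thesis using bernoulli_slope DERIV_unique[OF _ DERIV_const[of 0]] by simp
  qed
  have identity: "slope_form (- U 0 0 ?p) (V 0 0 ?p) (U 1 0 ?p) b (- \<gamma> 0)
      + 4 * (V 0 0 ?p)^2 * ((U 0 0 ?p)^2 + (V 0 0 ?p)^2) * U 1 1 ?p - 4 * \<gamma>' 0 * (U 0 0 ?p)^2 * (V 0 0 ?p)^3 = 0"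
    using u by (intro slope_form_identity[OF _ s vx b_def bern dbern]) simp
  have "slope_form (- U 0 0 ?p) (V 0 0 ?p) (U 1 0 ?p) b (- \<gamma> 0) > 0"
  proof (rule slope_form_pos)
    show "- U 0 0 ?p * V 0 0 ?p * b = g * V 0 0 ?p + ((- U 0 0 ?p)^2 - (V 0 0 ?p)^2) * U 1 0 ?p"
      using bern by (simp add: algebra_simps)
    show "- \<gamma> 0 \<ge> 0" using \<gamma>_nonpos(1)[of 0] m_pos by simp
  qed (use u v a g_pos gravity_dominates[of x] x in auto)
  moreover have "4 * (V 0 0 ?p)^2 * ((U 0 0 ?p)^2 + (V 0 0 ?p)^2) * U 1 1 ?p \<ge> 0" using k by simp
  moreover have "- (4 * \<gamma>' 0 * (U 0 0 ?p)^2 * (V 0 0 ?p)^3) \<ge> 0"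
    using \<gamma>_nonpos(2)[of 0] m_pos v by (simp add: mult_nonpos_nonneg)
  ultimately show False using identity by linarith
qed

text \<open>The tangential derivative vanishes at such a maximum, and comparison with points
  straight below gives u_xy >= 0.\<close>

lemma Ux_no_surface_max:
  assumes x: "0 < x" "x < L" and pos: "U 1 0 (x, \<eta> x) \<ge> 0"
    and max: "\<And>p. p \<in> cell \<Longrightarrow> U 1 0 p \<le> U 1 0 (x, \<eta> x)"
  shows False
proof (rule no_critical_surface_point[OF x pos])
  let ?p = "(x, \<eta> x)"
  have "((\<lambda>x. U 1 0 (x, \<eta> x)) has_real_derivative U 2 0 ?p + \<eta>' x * U 1 1 ?p) (at x)"
    using U_surface_deriv[of 1 0 x] by (simp add: numeral_2_eq_2)
  then show "U 2 0 ?p + \<eta>' x * U 1 1 ?p = 0"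
  proof (rule DERIV_local_max)
    show "0 < min x (L - x)" using x by simp
    show "\<forall>y. \<bar>x - y\<bar> < min x (L - x) \<longrightarrow> U 1 0 (y, \<eta> y) \<le> U 1 0 ?p"
    proof (intro allI impI max surface_in_cell)
      fix y assume "\<bar>x - y\<bar> < min x (L - x)"
      then show "0 \<le> y" "y \<le> L" by auto
    qed
  qed
  show "U 1 1 ?p \<ge> 0"
  proof (rule ccontr)
    assume neg: "\<not> U 1 1 ?p \<ge> 0"
    have cont: "continuous_on {- d..\<eta> x} (\<lambda>t. U i j (x,t))" if "i + j \<le> 3" for i j
      by (rule continuous_on_compose2[OF U_cont[OF that]]) (auto simp: closure_\<Omega> intro!: continuous_intros)
    obtain r where r: "r > 0" "\<And>t. t \<in> {- d..\<eta> x} \<Longrightarrow> \<bar>t - \<eta> x\<bar> < r \<Longrightarrow> \<bar>U 1 1 (x,t) - U 1 1 ?p\<bar> < - U 1 1 ?p"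
      using cont[of 1 1] neg \<eta>_gt[of x] unfolding continuous_on_iff dist_real_def
      by (metis atLeastAtMost_iff linorder_not_le neg_0_less_iff_less one_add_one numeral_le_iff order_less_imp_le order_refl semiring_norm(69) semiring_norm(72))
    define y where "y = max (- d) (\<eta> x - r / 2)"
    have y: "- d \<le> y" "y < \<eta> x" "\<eta> x - y < r" using r(1) \<eta>_gt[of x] by (auto simp: y_def)
    have "U 1 0 (x,y) > U 1 0 ?p"
    proof (rule DERIV_neg_imp_decreasing_open[OF y(2)])
      fix t assume t: "y < t" "t < \<eta> x"
      have "((\<lambda>t. U 1 0 (x,t)) has_real_derivative U 1 1 (x,t)) (at t)"
        using partialsD(2)[OF U_partials[of 1 0], of x t] t y by (simp add: mem_strip)
      moreover have "U 1 1 (x,t) < 0" using r(2)[of t] t y neg by auto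
      ultimately show "\<exists>z. ((\<lambda>t. U 1 0 (x,t)) has_real_derivative z) (at t) \<and> z < 0" by blast
    next
      show "continuous_on {y..\<eta> x} (\<lambda>t. U 1 0 (x,t))"
        by (rule continuous_on_subset[OF cont]) (use y in auto)
    qed
    moreover have "(x,y) \<in> cell" using x y by (simp add: cell_def)
    ultimately show False using max by fastforce
  qed
qed

text \<open>Since v_y = -u_x, a positive value would push v below zero just above the bottom, where
  v starts from 0.\<close>

lemma Ux_bottom_nonpos:
  assumes x: "0 \<le> x" "x \<le> L"
  shows "U 1 0 (x, - d) \<le> 0"
proof (rule ccontr)
  assume pos: "\<not> U 1 0 (x, - d) \<le> 0"
  have "continuous_on {- d..\<eta> x} (\<lambda>t. U 1 0 (x,t))"
    by (rule continuous_on_compose2[OF U_cont]) (auto simp: closure_\<Omega> intro!: continuous_intros)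
  then obtain r where r: "r > 0" "\<And>t. t \<in> {- d..\<eta> x} \<Longrightarrow> \<bar>t - - d\<bar> < r \<Longrightarrow> \<bar>U 1 0 (x,t) - U 1 0 (x, - d)\<bar> < U 1 0 (x, - d)"
    using pos \<eta>_gt[of x] unfolding continuous_on_iff dist_real_def
    by (metis atLeastAtMost_iff linorder_not_le order_less_imp_le order_refl)
  define y where "y = min (\<eta> x) (- d + r / 2)"
  have y: "- d < y" "y \<le> \<eta> x" "y + d < r" using r(1) \<eta>_gt[of x] by (auto simp: y_def)
  have "V 0 0 (x, - d) > V 0 0 (x,y)"
  proof (rule DERIV_neg_imp_decreasing_open[OF y(1)])
    fix t assume t: "- d < t" "t < y"
    have "((\<lambda>t. V 0 0 (x,t)) has_real_derivative - U 1 0 (x,t)) (at t)"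
      using partialsD(2)[OF V_partials[of 0 0], of x t] incompressible[of "(x,t)"] t y by (simp add: mem_strip closure_\<Omega>)
    moreover have "- U 1 0 (x,t) < 0" using r(2)[of t] t y pos by auto
    ultimately show "\<exists>z. ((\<lambda>t. V 0 0 (x,t)) has_real_derivative z) (at t) \<and> z < 0" by blast
  next
    show "continuous_on {- d..y} (\<lambda>t. V 0 0 (x,t))"
      by (rule continuous_on_compose2[OF V_cont]) (use y in \<open>auto simp: closure_\<Omega> intro!: continuous_intros\<close>)
  qed
  then show False using V_nonneg[OF x, of y] y bottom[of x] by simp
qed

lemma cell_boundary_cases:
  assumes "p \<in> cell" "p \<notin> cell_interior"
  obtains y where "p = (0,y)" "- d \<le> y" "y \<le> \<eta> 0" | y where "p = (L,y)" "- d \<le> y" "y \<le> \<eta> L"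
    | x where "p = (x, - d)" "0 \<le> x" "x \<le> L" | x where "p = (x, \<eta> x)" "0 \<le> x" "x \<le> L"
proof -
  obtain x y where p: "p = (x,y)" by fastforce
  then have xy: "0 \<le> x" "x \<le> L" "- d \<le> y" "y \<le> \<eta> x"
    and "x = 0 \<or> x = L \<or> y = - d \<or> y = \<eta> x"
    using assms by (auto simp: cell_def cell_interior_def)
  then show ?thesis using that p by blast
qed

text \<open>M >= 0 is used twice: u_x vanishes on the sides and is nonpositive on the bottom, and
  where u_x > M the term -\<gamma>'(\<psi>) u_x is nonnegative.\<close>

lemma Ux_le_boundary:
  assumes M: "M \<ge> 0" and surf: "\<And>x. 0 \<le> x \<Longrightarrow> x \<le> L \<Longrightarrow> U 1 0 (x, \<eta> x) \<le> M" and p: "p \<in> cell"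
  shows "U 1 0 p \<le> M"
proof (rule weak_maximum_principle[OF compact_cell open_cell_interior cell_interior_subset(2) _ _ _ _ _ _ p])
  show "continuous_on cell (U 1 0)" using continuous_on_subset[OF U_cont cell_subset_closure] by simp
  show "partials cell_interior (U 1 0) (U 2 0) (U 1 1)" "partials cell_interior (U 2 0) (U 3 0) (U 2 1)"
    "partials cell_interior (U 1 1) (U 2 1) (U 1 2)"
    using U_partials[of 1 0] U_partials[of 2 0] U_partials[of 1 1] partials_subset[OF _ cell_interior_subset(1)]
    by (auto simp: numeral_2_eq_2 numeral_3_eq_3)
  show "U 1 0 q \<le> M" if "q \<in> cell" "q \<notin> cell_interior" for q
    using that
  proof (cases rule: cell_boundary_cases)
    case (1 y)
    then show ?thesis using Ux_sides[of 0 y] M by simp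
  next
    case (2 y)
    then show ?thesis using Ux_sides[of L y] M by simp
  next
    case (3 x)
    then show ?thesis using Ux_bottom_nonpos[of x] M by simp
  next
    case (4 x)
    then show ?thesis using surf by simp
  qed
  show "U 3 0 q + U 1 2 q \<ge> 0" if q: "q \<in> cell_interior" "U 1 0 q > M" for q
  proof -
    have qO: "q \<in> \<Omega>" and qc: "q \<in> cell" using q cell_interior_subset by auto
    have "V 0 0 q * U 0 0 q \<le> 0" using U_neg_cell[OF qc] V_nonneg_cell[OF qc] by (simp add: mult_nonneg_nonpos)
    moreover have "\<gamma>'' (\<psi> q) \<le> 0" "\<gamma>' (\<psi> q) \<le> 0" using \<gamma>_sign \<psi>_range[OF qO] by auto
    ultimately have "\<gamma>'' (\<psi> q) * (V 0 0 q * U 0 0 q) \<ge> 0" "\<gamma>' (\<psi> q) * U 1 0 q \<le> 0"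
      using q(2) M by (auto intro: mult_nonpos_nonpos mult_nonpos_nonneg)
    then show ?thesis using laplacian_Ux[OF qO] by (simp add: mult.assoc)
  qed
qed

text \<open>A positive surface maximum, taken as M in \<open>Ux_le_boundary\<close>, would be the
  maximum over the whole cell, contradicting \<open>Ux_no_surface_max\<close>.\<close>

lemma Ux_nonpos: "p \<in> cell \<Longrightarrow> U 1 0 p \<le> 0"
proof (rule Ux_le_boundary[of 0, OF order_refl])
  have "continuous_on {0..L} (\<lambda>x. U 1 0 (x, \<eta> x))"
    by (rule continuous_on_compose2[OF U_cont])
      (auto intro!: surface_in_closure continuous_on_Pair continuous_on_id continuous_on_subset[OF \<eta>_cont])
  then obtain x0 where x0: "0 \<le> x0" "x0 \<le> L" "\<And>x. 0 \<le> x \<Longrightarrow> x \<le> L \<Longrightarrow> U 1 0 (x, \<eta> x) \<le> U 1 0 (x0, \<eta> x0)"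
    using continuous_attains_sup[of "{0..L}" "\<lambda>x. U 1 0 (x, \<eta> x)"] L_pos by auto
  have "U 1 0 (x0, \<eta> x0) \<le> 0"
  proof (rule ccontr)
    assume pos: "\<not> U 1 0 (x0, \<eta> x0) \<le> 0"
    then have "x0 \<noteq> 0" "x0 \<noteq> L" using Ux_sides[of x0 "\<eta> x0"] \<eta>_gt[of x0] by auto
    then show False using Ux_no_surface_max[of x0] Ux_le_boundary[OF _ x0(3)] x0(1,2) pos by fastforce
  qed
  then show "U 1 0 (x, \<eta> x) \<le> 0" if "0 \<le> x" "x \<le> L" for x using x0(3)[OF that] by simp
qed

section \<open>From the surface to the whole domain\<close>

lemma surface_slope:
  assumes x: "0 \<le> x" "x \<le> L"
  shows "U 0 0 (x, \<eta> x) + V 0 0 (x, \<eta> x) < 0"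
proof (rule ccontr)
  let ?h = "\<lambda>x. U 0 0 (x, \<eta> x) + V 0 0 (x, \<eta> x)"
  have der: "(?h has_real_derivative U 1 0 (t, \<eta> t) + \<eta>' t * U 0 1 (t, \<eta> t) + (V 1 0 (t, \<eta> t) + \<eta>' t * V 0 1 (t, \<eta> t))) (at t)" for t
    using DERIV_add[OF U_surface_deriv[of 0 0 t] V_surface_deriv[of 0 0 t]] by simp
  then have cont: "continuous_on UNIV ?h" by (meson DERIV_isCont continuous_at_imp_continuous_on)
  assume "\<not> ?h x < 0"
  define Z where "Z = {0..L} \<inter> {t. 0 \<le> ?h t}"
  have "closed {t. 0 \<le> ?h t}" by (intro closed_Collect_le cont continuous_on_const)
  then have Z: "compact Z" "Z \<noteq> {}" using x \<open>\<not> ?h x < 0\<close> unfolding Z_def by (auto intro: compact_Int_closed)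
  obtain x0 where x0: "x0 \<in> Z" "\<And>t. t \<in> Z \<Longrightarrow> x0 \<le> t"
    using compact_attains_inf[OF Z] by blast
  have ends: "?h 0 < 0" "?h L < 0"
    using V_sides(1)[of "\<eta> 0"] V_sides(2)[of "\<eta> L"] \<eta>_gt[of 0] \<eta>_gt[of L]
      U_neg[OF surface_in_closure[of 0]] U_neg[OF surface_in_closure[of L]] by auto
  then have x0': "0 < x0" "x0 < L" using x0(1) by (auto simp: Z_def order_le_less)
  have before: "?h t < 0" if "0 \<le> t" "t < x0" for t
    using x0(2)[of t] that x0' by (auto simp: Z_def not_le[symmetric])
  have zero: "?h x0 = 0"
  proof -
    have "?h x0 \<le> 0"
    proof (rule tendsto_upperbound)
      show "(?h \<longlongrightarrow> ?h x0) (at_left x0)"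
        using cont by (meson continuous_on_def UNIV_I tendsto_within_subset subset_UNIV)
      show "\<forall>\<^sub>F t in at_left x0. ?h t \<le> 0"
        using before x0' by (intro eventually_at_leftI[of 0]) (auto intro: less_imp_le)
    qed simp
    then show ?thesis using x0(1) by (simp add: Z_def)
  qed
  let ?p = "(x0, \<eta> x0)"
  have u: "U 0 0 ?p < 0" by (rule U_neg[OF surface_in_closure])
  have "\<eta>' x0 * U 0 0 ?p = - 1 * U 0 0 ?p" using zero surface(2)[of x0] by simp
  then have s: "\<eta>' x0 = - 1" using u by (subst (asm) mult_right_cancel) auto
  \<comment> \<open>u + v is negative before x0 and zero at x0, so its derivative there is
    nonnegative. With \<eta>' = -1 the terms -u_y + v_x combine to \<gamma>(0).\<close>
  have "2 * U 1 0 ?p + \<gamma> 0 \<ge> 0"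
  proof (rule ccontr)
    assume "\<not> 2 * U 1 0 ?p + \<gamma> 0 \<ge> 0"
    then have neg: "2 * U 1 0 ?p + \<gamma> 0 < 0" by simp
    have "(?h has_real_derivative 2 * U 1 0 ?p + \<gamma> 0) (at x0)"
      using der[of x0] s vorticity_surface[of x0] incompressible[OF surface_in_closure, of x0]
      by (auto elim!: DERIV_cong)
    from DERIV_neg_dec_left[OF this neg]
    obtain r where r: "r > 0" "\<And>e. 0 < e \<Longrightarrow> e < r \<Longrightarrow> ?h x0 < ?h (x0 - e)" by blast
    define e where "e = min r x0 / 2"
    have "0 < e" "e < r" "e < x0" using r x0' by (auto simp: e_def)
    then show False using r(2)[of e] before[of "x0 - e"] zero by auto
  qed
  \<comment> \<open>As u_x <= 0 on the whole cell, u_x would attain its maximum 0 at this surface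
    point.\<close>
  then have "U 1 0 ?p \<ge> 0" using \<gamma>_nonpos(1)[of 0] m_pos by simp
  then show False
    using Ux_no_surface_max[OF x0'] Ux_nonpos by force
qed

text \<open>u and v both solve \<Delta>f = -\<gamma>'(\<psi>) f. Any linear combination does too,
  and is subharmonic where it is positive because \<gamma>' <= 0.\<close>

lemma cell_slope:
  assumes p: "p \<in> cell"
  shows "U 0 0 p + V 0 0 p < 0"
proof -
  let ?h = "\<lambda>x. U 0 0 (x, \<eta> x) + V 0 0 (x, \<eta> x)"
  have c: "continuous_on {0..L} (\<lambda>x. U 0 0 (x, \<eta> x))" "continuous_on {0..L} (\<lambda>x. V 0 0 (x, \<eta> x))"
    by (rule continuous_on_compose2[OF U_cont] continuous_on_compose2[OF V_cont];
      auto intro!: surface_in_closure continuous_on_Pair continuous_on_id continuous_on_subset[OF \<eta>_cont])+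
  obtain x0 where x0: "0 \<le> x0" "x0 \<le> L" "\<And>x. 0 \<le> x \<Longrightarrow> x \<le> L \<Longrightarrow> ?h x \<le> ?h x0"
    using continuous_attains_sup[of "{0..L}" ?h, OF _ _ continuous_on_add[OF c]] L_pos by auto
  obtain x1 where x1: "0 \<le> x1" "x1 \<le> L" "\<And>x. 0 \<le> x \<Longrightarrow> x \<le> L \<Longrightarrow> U 0 0 (x1, \<eta> x1) \<le> U 0 0 (x, \<eta> x)"
    using continuous_attains_inf[of "{0..L}" "\<lambda>x. U 0 0 (x, \<eta> x)", OF _ _ c(1)] L_pos by auto
  define \<epsilon> B where "\<epsilon> = - ?h x0" and "B = - U 0 0 (x1, \<eta> x1)"
  have \<epsilon>: "\<epsilon> > 0" using surface_slope[OF x0(1,2)] by (simp add: \<epsilon>_def)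
  have B: "B > 0" using U_neg[OF surface_in_closure] by (simp add: B_def)
  (* Comparing with a multiple of u < 0, which solves the same equation, makes the inequality strict. *)
  define \<delta> where "\<delta> = min 1 (\<epsilon> / B)"
  have \<delta>: "0 < \<delta>" "\<delta> \<le> 1" "\<delta> * B \<le> \<epsilon>" using \<epsilon> B by (auto simp: \<delta>_def min_def field_simps)
  let ?f = "\<lambda>p. (1 - \<delta>) * U 0 0 p + V 0 0 p"
  have "?f p \<le> 0"
  proof (rule weak_maximum_principle[OF compact_cell open_cell_interior cell_interior_subset(2) _ _ _ _ _ _ p])
    have cell: "continuous_on cell (U 0 0)" "continuous_on cell (V 0 0)"
      using continuous_on_subset[OF U_cont cell_subset_closure] continuous_on_subset[OF V_cont cell_subset_closure] by simp_all
    show "continuous_on cell ?f" by (intro continuous_intros cell)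
    show "partials cell_interior ?f (\<lambda>p. (1 - \<delta>) * U 1 0 p + V 1 0 p) (\<lambda>p. (1 - \<delta>) * U 0 1 p + V 0 1 p)"
      "partials cell_interior (\<lambda>p. (1 - \<delta>) * U 1 0 p + V 1 0 p) (\<lambda>p. (1 - \<delta>) * U 2 0 p + V 2 0 p) (\<lambda>p. (1 - \<delta>) * U 1 1 p + V 1 1 p)"
      "partials cell_interior (\<lambda>p. (1 - \<delta>) * U 0 1 p + V 0 1 p) (\<lambda>p. (1 - \<delta>) * U 1 1 p + V 1 1 p) (\<lambda>p. (1 - \<delta>) * U 0 2 p + V 0 2 p)"
      using partials_subset[OF partials_add[OF partials_cmult[OF U_partials] V_partials] cell_interior_subset(1), of 0 0 0 0 "1 - \<delta>"]
        partials_subset[OF partials_add[OF partials_cmult[OF U_partials] V_partials] cell_interior_subset(1), of 1 0 1 0 "1 - \<delta>"]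
        partials_subset[OF partials_add[OF partials_cmult[OF U_partials] V_partials] cell_interior_subset(1), of 0 1 0 1 "1 - \<delta>"]
      by (simp_all add: numeral_2_eq_2)
    show "?f q \<le> 0" if q: "q \<in> cell" "q \<notin> cell_interior" for q
      using q
    proof (cases rule: cell_boundary_cases)
      \<comment> \<open>On the surface (1 - \<delta>) u + v = (u + v) - \<delta> u <= -\<epsilon> +
        \<delta> B. On the other sides v = 0, and \<delta> <= 1 settles the sign.\<close>
      case (4 x)
      have "\<delta> * - U 0 0 q \<le> \<delta> * B" using x1(3)[of x] 4 \<delta> by (intro mult_left_mono) (auto simp: B_def)
      moreover have "U 0 0 q + V 0 0 q \<le> - \<epsilon>" using x0(3)[of x] 4 by (simp add: \<epsilon>_def)
      ultimately show ?thesis using \<delta>(3) by (simp add: algebra_simps)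
    qed (use V_sides bottom U_neg_cell[OF q(1)] \<delta> in \<open>auto intro: mult_nonneg_nonpos less_imp_le\<close>)
    show "(1 - \<delta>) * U 2 0 q + V 2 0 q + ((1 - \<delta>) * U 0 2 q + V 0 2 q) \<ge> 0"
      if q: "q \<in> cell_interior" "?f q > 0" for q
    proof -
      have qO: "q \<in> \<Omega>" using q cell_interior_subset by auto
      have "(1 - \<delta>) * U 2 0 q + V 2 0 q + ((1 - \<delta>) * U 0 2 q + V 0 2 q)
          = (1 - \<delta>) * (U 2 0 q + U 0 2 q) + (V 2 0 q + V 0 2 q)" by (simp add: algebra_simps)
      also have "\<dots> = - \<gamma>' (\<psi> q) * ?f q"
        unfolding second_order_relations[OF qO] by (simp add: algebra_simps)
      also have "\<dots> \<ge> 0" using \<gamma>_sign(2) \<psi>_range[OF qO] q(2) by (simp add: mult_nonpos_nonneg)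
      finally show ?thesis .
    qed
  qed
  moreover have "\<delta> * U 0 0 p < 0" using \<delta>(1) U_neg_cell[OF p] by (simp add: mult_pos_neg)
  ultimately show ?thesis by (simp add: algebra_simps)
qed

text \<open>Reflection and translation carry the bound from the half period to all x, by induction
  on the number of periods.\<close>

lemma streamline_slope:
  assumes "p \<in> closure \<Omega>"
  shows "\<bar>V 0 0 p / U 0 0 p\<bar> < 1"
proof -
  define Q where "Q = (\<lambda>x. \<forall>y. (x,y) \<in> closure \<Omega> \<longrightarrow> \<bar>V 0 0 (x,y) / U 0 0 (x,y)\<bar> < 1)"
  have cell: "Q x" if "0 \<le> x" "x \<le> L" for x
  proof (unfold Q_def, intro allI impI)
    fix y assume "(x,y) \<in> closure \<Omega>"
    then have "(x,y) \<in> cell" using that by (simp add: cell_def closure_\<Omega>)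
    then show "\<bar>V 0 0 (x,y) / U 0 0 (x,y)\<bar> < 1"
      using cell_slope[of "(x,y)"] U_neg_cell[of "(x,y)"] V_nonneg_cell[of "(x,y)"]
      by (subst abs_divide, subst divide_less_eq_1_pos) auto
  qed
  have reflect: "Q (- x)" if "Q x" for x
    unfolding Q_def
  proof (intro allI impI)
    fix y assume "(- x,y) \<in> closure \<Omega>"
    then have "(x,y) \<in> closure \<Omega>" using closure_\<Omega>_symmetric by fastforce
    then show "\<bar>V 0 0 (- x,y) / U 0 0 (- x,y)\<bar> < 1" using that symmetric[of x y] unfolding Q_def by simp
  qed
  have shift: "Q (x + 2 * L)" if "Q x" for x
    unfolding Q_def
  proof (intro allI impI)
    fix y assume "(x + 2 * L,y) \<in> closure \<Omega>"
    then have "(x,y) \<in> closure \<Omega>" by (simp add: closure_\<Omega> \<eta>_periodic)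
    then show "\<bar>V 0 0 (x + 2 * L,y) / U 0 0 (x + 2 * L,y)\<bar> < 1" using that periodic[of x y] unfolding Q_def by simp
  qed
  have right: "0 \<le> x \<Longrightarrow> x \<le> L + 2 * L * real n \<Longrightarrow> Q x" for x n
  proof (induction n arbitrary: x)
    case 0
    then show ?case using cell by simp
  next
    case (Suc n)
    show ?case
    proof (cases "x \<le> L + 2 * L * real n")
      case True
      then show ?thesis using Suc by blast
    next
      case False
      then have "x > L" using L_pos by (smt (verit) mult_nonneg_nonneg of_nat_0_le_iff)
      have "Q (x - 2 * L)"
      \<comment> \<open>For L < x < 2 L the translate x - 2 L is negative, out of reach of the
        induction hypothesis; it is the mirror image of 2 L - x in the cell.\<close>
      proof (cases "x < 2 * L")
        case True
        then show ?thesis using reflect[OF cell[of "2 * L - x"]] \<open>x > L\<close> by simp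
      next
        case False
        then show ?thesis using Suc.IH[of "x - 2 * L"] Suc.prems by (simp add: algebra_simps)
      qed
      then show ?thesis using shift by fastforce
    qed
  qed
  have nonneg: "Q x" if "x \<ge> 0" for x
  proof -
    obtain n where "x / (2 * L) \<le> real n" using real_arch_simple by blast
    then have "x \<le> 2 * L * real n" using L_pos by (simp add: field_simps)
    then show ?thesis using right[of x n] that L_pos by simp
  qed
  have "Q x" for x
    using nonneg[of x] reflect[OF nonneg[of "- x"]] by (cases "x \<ge> 0") auto
  then show ?thesis using assms unfolding Q_def by (cases p) auto
qed

end

section \<open>The slope bound\<close>

lemma Dom_eq_strip: "Dom w = strip (wd w) (weta w)"
  by (simp add: Dom_def strip_def)

lemma monotone_wave_slope:
  assumes wave: "wave_with g L Patm w \<psi> m \<gamma>" and gL: "g > 0" "L > 0"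
    and mono: "monotone_wave L w"
    and trough: "g - \<gamma> 0 * wu w (L, weta w L) > 0"
    and p: "p \<in> closure (Dom w)"
  shows "\<bar>wv w p / wu w p\<bar> < 1"
proof -
  let ?S = "strip (wd w) (weta w)"
  note W = wave[unfolded wave_with_def Let_def Dom_eq_strip]
  have \<eta>4: "Ck_real 4 (weta w)" using W by blast
  have d1: "(deriv ^^ i) (weta w) differentiable (at x)" if "i < 4" for i x
    using \<eta>4 that unfolding Ck_real_def by blast
  have \<eta>d: "(weta w has_real_derivative deriv (weta w) x) (at x)" for x
    using d1[of 0 x] by (simp add: DERIV_deriv_iff_real_differentiable)
  have "isCont (deriv (weta w)) x" for x
    using d1[of 1 x] by (simp add: differentiable_imp_continuous_within)
  then have \<eta>c: "continuous_on UNIV (deriv (weta w))" by (simp add: continuous_at_imp_continuous_on)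
  have S: "open ?S"
    using \<eta>d by (intro open_strip) (meson DERIV_isCont continuous_at_imp_continuous_on)
  obtain U where U: "U 0 0 = wu w"
    "\<And>i j. i + j \<le> 3 \<Longrightarrow> continuous_on (closure ?S) (U i j)"
    "\<And>i j. i + j < 3 \<Longrightarrow> partials ?S (U i j) (U (Suc i) j) (U i (Suc j))"
    "\<And>i j p. i + j \<le> 3 \<Longrightarrow> p \<in> ?S \<Longrightarrow> U i j p = (pdx ^^ i) ((pdy ^^ j) (wu w)) p"
    using Ck_closure_extension[OF S, of 3 "wu w"] W by blast
  obtain V where V: "V 0 0 = wv w"
    "\<And>i j. i + j \<le> 3 \<Longrightarrow> continuous_on (closure ?S) (V i j)"
    "\<And>i j. i + j < 3 \<Longrightarrow> partials ?S (V i j) (V (Suc i) j) (V i (Suc j))"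
    "\<And>i j p. i + j \<le> 3 \<Longrightarrow> p \<in> ?S \<Longrightarrow> V i j p = (pdx ^^ i) ((pdy ^^ j) (wv w)) p"
    using Ck_closure_extension[OF S, of 3 "wv w"] W by blast
  obtain P where P: "P 0 0 = wP w"
    "\<And>i j. i + j \<le> 3 \<Longrightarrow> continuous_on (closure ?S) (P i j)"
    "\<And>i j. i + j < 3 \<Longrightarrow> partials ?S (P i j) (P (Suc i) j) (P i (Suc j))"
    "\<And>i j p. i + j \<le> 3 \<Longrightarrow> p \<in> ?S \<Longrightarrow> P i j p = (pdx ^^ i) ((pdy ^^ j) (wP w)) p"
    using Ck_closure_extension[OF S, of 3 "wP w"] W by blast
  have m: "m > 0" using W by blast
  obtain \<gamma>1 \<gamma>2 where \<gamma>: "C2_interval m \<gamma> \<gamma>1 \<gamma>2"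
    "\<And>s. s \<in> {0<..<m} \<Longrightarrow> \<gamma> s \<le> 0 \<and> \<gamma>1 s \<le> 0 \<and> \<gamma>2 s \<le> 0"
    using W by blast
  have first: "pdx (wu w) p = U 1 0 p" "pdy (wu w) p = U 0 1 p" "pdx (wv w) p = V 1 0 p" "pdy (wv w) p = V 0 1 p"
    "pdx (wP w) p = P 1 0 p" "pdy (wP w) p = P 0 1 p" if "p \<in> ?S" for p
    using U(4)[of 1 0 p] U(4)[of 0 1 p] V(4)[of 1 0 p] V(4)[of 0 1 p] P(4)[of 1 0 p] P(4)[of 0 1 p] that by auto
  have eqs: "wu w p * pdx (wu w) p + wv w p * pdy (wu w) p = - pdx (wP w) p"
    "wu w p * pdx (wv w) p + wv w p * pdy (wv w) p = - pdy (wP w) p - g"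
    "pdx (wu w) p + pdy (wv w) p = 0" "pdx (wv w) p - pdy (wu w) p = \<gamma> (\<psi> p)" if "p \<in> ?S" for p
    using W that by blast+
  have \<psi>: "partials ?S \<psi> (\<lambda>p. - wv w p) (wu w)"
  proof -
    \<comment> \<open>\<open>deriv\<close> is total, so differentiability has to travel with the
      values of \<open>pdx\<close> and \<open>pdy\<close>.\<close>
    have "(\<lambda>t. \<psi> (fst p, t)) differentiable (at (snd p)) \<and> (\<lambda>s. \<psi> (s, snd p)) differentiable (at (fst p))
        \<and> pdy \<psi> p = wu w p \<and> pdx \<psi> p = - wv w p" if "p \<in> ?S" for p
      using W that by blast
    note D = this
    show ?thesis
      unfolding partials_def
    proof (intro allI impI conjI)
      fix x y assume q: "(x,y) \<in> ?S"
      have "(\<lambda>s. \<psi> (s,y)) differentiable (at x)" "deriv (\<lambda>s. \<psi> (s,y)) x = - wv w (x,y)"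
        using D[OF q] by (simp_all add: pdx_def)
      then show "((\<lambda>s. \<psi> (s,y)) has_real_derivative - wv w (x,y)) (at x)"
        by (simp flip: DERIV_deriv_iff_real_differentiable)
      have "(\<lambda>t. \<psi> (x,t)) differentiable (at y)" "deriv (\<lambda>t. \<psi> (x,t)) y = wu w (x,y)"
        using D[OF q] by (simp_all add: pdy_def)
      then show "((\<lambda>t. \<psi> (x,t)) has_real_derivative wu w (x,y)) (at y)"
        by (simp flip: DERIV_deriv_iff_real_differentiable)
    qed
  qed
  interpret favorable_wave g L "wd w" Patm m "weta w" "deriv (weta w)" U V P \<psi> \<gamma> \<gamma>1 \<gamma>2
  proof (unfold_locales, unfold U(1) V(1) P(1))
    show "\<exists>c<0. \<forall>p\<in>?S. wu w p \<le> c" using W by blast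
    show "continuous_on (closure ?S) \<psi>" using W by blast
    show "(\<gamma> has_real_derivative \<gamma>1 s) (at s within {0..m})" "(\<gamma>1 has_real_derivative \<gamma>2 s) (at s within {0..m})"
      if "s \<in> {0..m}" for s using \<gamma>(1) that unfolding C2_interval_def by blast+
    show "wv w (x,y) > 0" if "0 < x" "x < L" "- wd w < y" "y \<le> weta w x" for x y
      using mono that unfolding monotone_wave_def by (cases "y = weta w x") auto
    show "wu w p * U 1 0 p + wv w p * U 0 1 p = - P 1 0 p"
      "wu w p * V 1 0 p + wv w p * V 0 1 p = - P 0 1 p - g" "U 1 0 p + V 0 1 p = 0"
      "V 1 0 p - U 0 1 p = \<gamma> (\<psi> p)" if "p \<in> ?S" for p
      using eqs[OF that] unfolding first[OF that] by auto
    show "\<gamma> s \<le> 0" "\<gamma>1 s \<le> 0" "\<gamma>2 s \<le> 0" if "0 < s" "s < m" for s using \<gamma>(2)[of s] that by auto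
    fix x y
    show "- wd w < weta w x" "weta w (x + 2 * L) = weta w x" "weta w (- x) = weta w x"
      "wP w (x, weta w x) = Patm" "wv w (x, weta w x) = deriv (weta w) x * wu w (x, weta w x)"
      "wv w (x, - wd w) = 0" "\<psi> (x, weta w x) = 0" "\<psi> (x, - wd w) = m"
      using W by (auto simp: minus_less_iff)
    assume "(x,y) \<in> closure ?S"
    then show "wu w (x + 2 * L, y) = wu w (x,y)" "wv w (x + 2 * L, y) = wv w (x,y)"
      "wu w (- x, y) = wu w (x,y)" "wv w (- x, y) = - wv w (x,y)"
      using W by blast+
  qed (fact gL m trough \<eta>d \<eta>c \<psi> U(2,3) V(2,3) P(2,3))+
  show ?thesis using streamline_slope[of p] p by (simp add: Dom_eq_strip U(1) V(1))
qed

text \<open>v is odd in x and independent of x; the domain is symmetric, so both facts apply at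
  mirror points.\<close>

lemma trivial_wave_vertical_velocity:
  assumes wave: "wave_with g L Patm w \<psi> m \<gamma>" and triv: "trivial_wave w"
    and p: "p \<in> closure (Dom w)"
  shows "wv w p = 0"
proof -
  obtain x y where xy: "p = (x,y)" by fastforce
  have odd: "\<And>x y. (x,y) \<in> closure (Dom w) \<Longrightarrow> wv w (- x, y) = - wv w (x,y)"
    and even: "\<And>x. weta w (- x) = weta w x"
    using wave unfolding wave_with_def Let_def by blast+
  let ?r = "\<lambda>p::real \<times> real. (- fst p, snd p)"
  have "?r ` Dom w \<subseteq> Dom w" by (auto simp: Dom_def even)
  then have "?r ` closure (Dom w) \<subseteq> closure (Dom w)"
    using closure_subset[of "Dom w"] by (intro image_closure_subset) (auto intro!: continuous_intros)
  then have "(- x,y) \<in> closure (Dom w)" using p xy by force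
  then have "wv w (- x,y) = wv w (x,y)" using triv p xy unfolding trivial_wave_def by blast
  then show ?thesis using odd[of x y] p xy by simp
qed

theorem theorem2p2:
  fixes g L Patm :: real and C :: "wave set"
  assumes "g > 0" and "L > 0"
    and "C \<subseteq> Waves g L Patm"
    and "connectedin (C0top L) (tau L ` C)"
    and "\<exists>w\<in>C. trivial_wave w"
    and "\<forall>w\<in>C. \<forall>\<psi> m \<gamma>. wave_with g L Patm w \<psi> m \<gamma> \<longrightarrow>
            g - \<gamma> 0 * wu w (L, weta w L) > 0"
  shows "\<forall>w\<in>C. \<forall>p\<in>closure (Dom w). \<bar>wv w p / wu w p\<bar> < 1"
proof (intro ballI)
  fix w p assume w: "w \<in> C" and p: "p \<in> closure (Dom w)"
  then obtain \<psi> m \<gamma> where wave: "wave_with g L Patm w \<psi> m \<gamma>"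
    and alt: "monotone_wave L w \<or> trivial_wave w"
    using assms(3) by (auto simp: Waves_def is_wave_def)
  \<comment> \<open>The trough condition is assumed for every triple (\<psi>, m, \<gamma>) belonging
    to the wave, hence for the one just chosen.\<close>
  have trough: "g - \<gamma> 0 * wu w (L, weta w L) > 0" using assms(6) w wave by blast
  from alt show "\<bar>wv w p / wu w p\<bar> < 1"
  proof
    assume "monotone_wave L w"
    then show ?thesis by (rule monotone_wave_slope[OF wave assms(1,2) _ trough p])
  next
    assume "trivial_wave w"
    then show ?thesis using trivial_wave_vertical_velocity[OF wave _ p] by simp
  qed
qed

end
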